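(* For every integer $n>1$, $$\tau(n)\leq 4n\log_2 n-4n\log_2\log_2 n+10n+1.$$ Consequently, the list of two-letter words needed in Specht's criterion, i.e. the set of all words in two letters of length at most $\tau(n)$, has size at most $\left(\frac{n}{\log_2 n}\right)^{4n}2^{O(n)}$; that is, there is an absolute constant $C$ such that for every integer $n>1$ the number of such words is at most $\left(\frac{n}{\log_2 n}\right)^{4n}2^{Cn}$.
   Context: Two matrices $A,B\in \mathrm{Mat}_n(\mathbb{C})$ are unitarily similar, written $A\sim_u B$, if $B=U^*AU$ for some unitary matrix $U$. A word $w$ in two letters $x,y$ is a finite (possibly empty) product of the noncommuting letters $x,y$; its length is its number of letters, and $w(A,A^* )$ denotes the matrix obtained by substituting $x=A$ and $y=A^*$ (conjugate transpose), the empty word giving the identity matrix. Specht's criterion (theorem) states that $A\sim_u B$ if and only if $\mathrm{tr}\, w(A,A^* )=\mathrm{tr}\, w(B,B^* )$ for all words $w$. The terseness $\tau(n)$ is the least integer $\geq 0$ such that, for every $A,B\in \mathrm{Mat}_n(\mathbb{C})$, $A\sim_u B$ if and only if $\mathrm{tr}\, w(A,A^* )=\mathrm{tr}\, w(B,B^* )$ for all words $w$ of length at most $\tau(n)$. *)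

theory Defs
  imports Complex_Main "Jordan_Normal_Form.Schur_Decomposition"
begin

lemma mat_adjoint_conjugate_transpose:
  fixes A :: "complex mat"
  shows "mat_adjoint A = mat (dim_col A) (dim_row A) (\<lambda>(i, j). cnj (A $$ (j, i)))"
  by (rule eq_matI) (auto simp: mat_adjoint_def mat_of_rows_def conjugate_complex_def)

definition unitary_mat :: "complex mat \<Rightarrow> bool" where
  "unitary_mat U \<longleftrightarrow> square_mat U \<and>
     mat_adjoint U * U = 1\<^sub>m (dim_row U) \<and> U * mat_adjoint U = 1\<^sub>m (dim_row U)"

definition unitarily_similar :: "nat \<Rightarrow> complex mat \<Rightarrow> complex mat \<Rightarrow> bool" where
  "unitarily_similar n A B \<longleftrightarrow>
     (\<exists>U \<in> carrier_mat n n. unitary_mat U \<and> B = mat_adjoint U * A * U)"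

definition mat_trace :: "complex mat \<Rightarrow> complex" where
  "mat_trace A = (\<Sum>i<dim_row A. A $$ (i, i))"

datatype letter = Lx | Ly

fun word_eval :: "nat \<Rightarrow> letter list \<Rightarrow> complex mat \<Rightarrow> complex mat \<Rightarrow> complex mat" where
  "word_eval n [] P Q = 1\<^sub>m n"
| "word_eval n (Lx # w) P Q = P * word_eval n w P Q"
| "word_eval n (Ly # w) P Q = Q * word_eval n w P Q"

definition words_upto :: "nat \<Rightarrow> letter list set" where
  "words_upto k = {w. length w \<le> k}"

definition specht_words_suffice :: "nat \<Rightarrow> nat \<Rightarrow> bool" where
  "specht_words_suffice n k \<longleftrightarrow>
     (\<forall>A \<in> carrier_mat n n. \<forall>B \<in> carrier_mat n n.
        unitarily_similar n A B \<longleftrightarrow>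
        (\<forall>w \<in> words_upto k.
           mat_trace (word_eval n w A (mat_adjoint A)) =
           mat_trace (word_eval n w B (mat_adjoint B))))"

text \<open>
  If no length sufficed for a given \<open>n\<close>, the value of \<open>LEAST\<close> would be an unspecified natural
  number; so an upper bound on \<open>terseness n\<close> is informative only because some length does suffice.
\<close>

definition terseness :: "nat \<Rightarrow> nat" where
  "terseness n = (LEAST k. specht_words_suffice n k)"

end

theory Submission
  imports Defs
begin

text \<open>
  Write \<open>A'\<close> for the adjoint of \<open>A\<close> and let \<open>V k\<close> be the span of the words of length at most \<open>k\<close>
  in \<open>A\<close> and \<open>A'\<close>. The proof has two halves: a bound \<open>l = O(n log n)\<close> on the length of the
  algebra generated by \<open>A\<close> and \<open>A'\<close> (all words lie in \<open>V l\<close>), and the fact that traces of words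
  of length at most \<open>2 * l + 2\<close> then determine \<open>A\<close> up to unitary similarity.

  \<^bold>\<open>Length.\<close> A projection \<open>e\<close> in \<open>V k\<close> of rank \<open>r\<close> is traded for one of smaller rank as follows.
  Choose a maximal number \<open>d\<close> of elements \<open>a i\<close> of \<open>V i\<close> such that the \<open>a i * e\<close> are partial
  isometries with initial projection \<open>e\<close> and pairwise orthogonal ranges; counting ranks gives
  \<open>d * r \<le> n\<close>. If the corner \<open>e * V (2 * d) * e\<close> consists of scalars, then the Gram-Schmidt
  process could enlarge the system unless the sum of the ranges is invariant, so the system is
  closed under multiplication by \<open>A\<close> and \<open>A'\<close> (\<open>closed_system_or_nonscalar\<close>). Otherwise the
  corner contains a nonscalar self-adjoint element. If it has \<open>m\<close> eigenvalues, one of its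
  spectral projections has rank at most \<open>r / m\<close> and is a polynomial of degree \<open>m - 1\<close> in it,
  so it lies in \<open>V (m * k + (m - 1) * 2 * d)\<close> (\<open>shrink_projection\<close>). Along this process the
  product of \<open>k\<close> and the rank stays below \<open>n * log 2 (n / r)\<close>, so a closed system is
  reached with \<open>k \<le> n * log 2 n\<close> (\<open>closed_system_exists\<close>). A closed system spans a two-sided
  ideal, and its range projection is central and splits off a full matrix block. Induction on
  the remaining part gives \<open>words_span_stable\<close> with \<open>l\<close> about \<open>n * log 2 n + 2 * n\<close>.

  \<^bold>\<open>Similarity.\<close> For two matrices \<open>A\<close> and \<open>B\<close>, let \<open>D\<close> be their block diagonal sum and \<open>G\<close>, \<open>H\<close>
  the two block projections, which commute with \<open>D\<close>. By faithfulness of the trace, a linear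
  relation between words that holds on the block \<open>G\<close> holds on \<open>H\<close> as soon as sufficiently many
  traces agree (\<open>relation_transfer\<close>). Together with the length bound this extends agreement of the
  traces from words of length at most \<open>2 * l + 2\<close> to all words. A closed system below \<open>G\<close> is then
  described by relations that also hold below \<open>H\<close>, and matching the two copies produces a
  partial isometry that commutes with \<open>D\<close>. Exhausting \<open>G\<close> and \<open>H\<close> in this way yields a
  \<open>T\<close> commuting with \<open>D\<close> that maps one block isometrically onto the other
  (\<open>commuting_projections_equivalent\<close>); its off-diagonal block is the required unitary matrix.

  Altogether \<open>terseness n \<le> 2 * n * log 2 n + 4 * n\<close>, which implies the stated bound because
  \<open>2 * log 2 L \<le> L + 3\<close> for \<open>L = log 2 n\<close>.
\<close>

section \<open>The *-algebra of finitely supported matrices\<close>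

text \<open>
  The argument passes constantly between matrices of different sizes: corners, direct sums and
  complements of invariant subspaces. Finitely supported infinite matrices put all of them into a
  single ring type. The ring has no unit; a projection plays this role in each corner.
\<close>

typedef fmat = "{f :: nat \<Rightarrow> nat \<Rightarrow> complex. \<exists>N. \<forall>i j. N \<le> i \<or> N \<le> j \<longrightarrow> f i j = 0}"
  morphisms entry Abs_fmat
  by (rule exI[of _ "\<lambda>_ _. 0"]) simp

setup_lifting type_definition_fmat

lemma fmat_eqI: "(\<And>i j. entry a i j = entry b i j) \<Longrightarrow> a = b"
  by (metis entry_inject ext)

definition supp_below :: "nat \<Rightarrow> fmat \<Rightarrow> bool" where
  "supp_below N a \<longleftrightarrow> (\<forall>i j. N \<le> i \<or> N \<le> j \<longrightarrow> entry a i j = 0)"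

lemma supp_below_exists: "\<exists>N. supp_below N a"
  using entry[of a] by (auto simp: supp_below_def)

lemma supp_below_mono: "supp_below N a \<Longrightarrow> N \<le> M \<Longrightarrow> supp_below M a"
  by (meson order_trans supp_below_def)

lemma supp_below_exists2: "\<exists>N. supp_below N a \<and> supp_below N b"
proof -
  obtain N M where "supp_below N a" "supp_below M b"
    using supp_below_exists by meson
  then show ?thesis
    by (intro exI[of _ "max N M"]) (auto elim: supp_below_mono)
qed

lemma supp_below_exists3: "\<exists>N. supp_below N a \<and> supp_below N b \<and> supp_below N c"
proof -
  obtain N M where "supp_below N a" "supp_below N b" "supp_below M c"
    using supp_below_exists2 supp_below_exists by meson
  then show ?thesis
    by (intro exI[of _ "max N M"]) (auto elim: supp_below_mono)
qed

instantiation fmat :: ab_group_add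
begin

lift_definition zero_fmat :: fmat is "\<lambda>_ _. 0" by simp

lift_definition plus_fmat :: "fmat \<Rightarrow> fmat \<Rightarrow> fmat" is "\<lambda>f g i j. f i j + g i j"
proof -
  fix f g :: "nat \<Rightarrow> nat \<Rightarrow> complex"
  assume "\<exists>N. \<forall>i j. N \<le> i \<or> N \<le> j \<longrightarrow> f i j = 0" "\<exists>N. \<forall>i j. N \<le> i \<or> N \<le> j \<longrightarrow> g i j = 0"
  then obtain N M where "\<forall>i j. N \<le> i \<or> N \<le> j \<longrightarrow> f i j = 0"
    "\<forall>i j. M \<le> i \<or> M \<le> j \<longrightarrow> g i j = 0" by blast
  then show "\<exists>N. \<forall>i j. N \<le> i \<or> N \<le> j \<longrightarrow> f i j + g i j = 0"
    by (intro exI[of _ "max N M"]) auto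
qed

lift_definition uminus_fmat :: "fmat \<Rightarrow> fmat" is "\<lambda>f i j. - f i j" by simp

definition minus_fmat :: "fmat \<Rightarrow> fmat \<Rightarrow> fmat" where "minus_fmat a b = a + - b"

instance
  by standard (auto simp: minus_fmat_def intro!: fmat_eqI simp: plus_fmat.rep_eq
      zero_fmat.rep_eq uminus_fmat.rep_eq)

end

lemma entry_zero [simp]: "entry 0 i j = 0"
  by (simp add: zero_fmat.rep_eq)

lemma entry_add [simp]: "entry (a + b) i j = entry a i j + entry b i j"
  by (simp add: plus_fmat.rep_eq)

lemma entry_diff [simp]: "entry (a - b) i j = entry a i j - entry b i j"
  by (simp only: minus_fmat_def plus_fmat.rep_eq uminus_fmat.rep_eq ab_group_add_class.ab_diff_conv_add_uminus)

lift_definition smul :: "complex \<Rightarrow> fmat \<Rightarrow> fmat" (infixr "*\<^sub>C" 75) is "\<lambda>c f i j. c * f i j"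
  by auto

lemma entry_smul [simp]: "entry (c *\<^sub>C a) i j = c * entry a i j"
  by (simp add: smul.rep_eq)

interpretation fmat: vector_space smul
  by standard (auto intro!: fmat_eqI simp: algebra_simps)

instantiation fmat :: ring
begin

lift_definition times_fmat :: "fmat \<Rightarrow> fmat \<Rightarrow> fmat" is
  "\<lambda>f g i j. \<Sum>k | f i k \<noteq> 0. f i k * g k j"
proof -
  fix f g :: "nat \<Rightarrow> nat \<Rightarrow> complex"
  assume "\<exists>N. \<forall>i j. N \<le> i \<or> N \<le> j \<longrightarrow> f i j = 0" "\<exists>N. \<forall>i j. N \<le> i \<or> N \<le> j \<longrightarrow> g i j = 0"
  then obtain N M where "\<forall>i j. N \<le> i \<or> N \<le> j \<longrightarrow> f i j = 0"
    "\<forall>i j. M \<le> i \<or> M \<le> j \<longrightarrow> g i j = 0" by blast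
  then show "\<exists>N. \<forall>i j. N \<le> i \<or> N \<le> j \<longrightarrow> (\<Sum>k | f i k \<noteq> 0. f i k * g k j) = 0"
    by (intro exI[of _ "max N M"]) (auto intro!: sum.neutral)
qed

lemma entry_times:
  assumes "supp_below N a"
  shows "entry (a * b) i j = (\<Sum>k<N. entry a i k * entry b k j)"
proof -
  have "(\<Sum>k | entry a i k \<noteq> 0. entry a i k * entry b k j) = (\<Sum>k<N. entry a i k * entry b k j)"
    using assms by (intro sum.mono_neutral_left) (auto simp: supp_below_def not_le[symmetric])
  then show ?thesis by (simp add: times_fmat.rep_eq)
qed

lemma supp_below_times: "supp_below N a \<Longrightarrow> supp_below N b \<Longrightarrow> supp_below N (a * b)"
  unfolding supp_below_def[of N "a * b"]
  by (auto simp: entry_times[of N a] supp_below_def)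

instance
proof
  fix a b c :: fmat
  obtain N where N: "supp_below N a" "supp_below N b" "supp_below N c"
    using supp_below_exists3 by blast
  have ab: "supp_below N (a * b)" using N supp_below_times by blast
  show "a * b * c = a * (b * c)"
  proof (rule fmat_eqI)
    fix i j
    have "entry (a * b * c) i j = (\<Sum>k<N. \<Sum>l<N. entry a i l * entry b l k * entry c k j)"
      using N ab by (simp add: entry_times[of N] sum_distrib_right)
    also have "\<dots> = (\<Sum>l<N. \<Sum>k<N. entry a i l * entry b l k * entry c k j)"
      by (rule sum.swap)
    also have "\<dots> = entry (a * (b * c)) i j"
      using N by (simp add: entry_times[of N] sum_distrib_left mult.assoc)
    finally show "entry (a * b * c) i j = entry (a * (b * c)) i j" .
  qed
  have apb: "supp_below N (a + b)" using N by (simp add: supp_below_def)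
  show "(a + b) * c = a * c + b * c"
    using N apb by (intro fmat_eqI) (simp add: entry_times[of N] sum.distrib distrib_right)
  show "a * (b + c) = a * b + a * c"
    using N by (intro fmat_eqI) (simp add: entry_times[of N] sum.distrib distrib_left)
qed

end

lemma smul_mult_left [simp]: "(c *\<^sub>C a) * b = c *\<^sub>C (a * b)"
proof -
  obtain N where N: "supp_below N a" "supp_below N (c *\<^sub>C a)"
    using supp_below_exists2 by blast
  then show ?thesis
    by (intro fmat_eqI) (simp add: entry_times[of N] sum_distrib_left mult.assoc)
qed

lemma smul_mult_right [simp]: "a * (c *\<^sub>C b) = c *\<^sub>C (a * b)"
proof -
  obtain N where N: "supp_below N a"
    using supp_below_exists by blast
  then show ?thesis
    by (intro fmat_eqI) (simp add: entry_times[of N] sum_distrib_left mult_ac)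
qed

lift_definition adj :: "fmat \<Rightarrow> fmat" is "\<lambda>f i j. cnj (f j i)" by auto

lemma entry_adj [simp]: "entry (adj a) i j = cnj (entry a j i)"
  by (simp add: adj.rep_eq)

lemma adj_adj [simp]: "adj (adj a) = a"
  and adj_zero [simp]: "adj 0 = 0"
  and adj_add [simp]: "adj (a + b) = adj a + adj b"
  and adj_diff [simp]: "adj (a - b) = adj a - adj b"
  and adj_smul [simp]: "adj (c *\<^sub>C a) = cnj c *\<^sub>C adj a"
  by (auto intro!: fmat_eqI)

lemma supp_below_adj: "supp_below N a \<Longrightarrow> supp_below N (adj a)"
  by (auto simp: supp_below_def)

lemma adj_mult [simp]: "adj (a * b) = adj b * adj a"
proof -
  obtain N where N: "supp_below N a" "supp_below N b" using supp_below_exists2 by blast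
  then show ?thesis
    using supp_below_adj[OF N(2)]
    by (intro fmat_eqI) (simp add: entry_times[of N] mult.commute)
qed

lemma adj_sum: "adj (\<Sum>i\<in>S. f i) = (\<Sum>i\<in>S. adj (f i))"
  by (induction S rule: infinite_finite_induct) auto

definition tr :: "fmat \<Rightarrow> complex" where
  "tr a = (\<Sum>i | entry a i i \<noteq> 0. entry a i i)"

text \<open>
  Traces of projections are real; the real part makes them comparable as ranks.
\<close>

definition rtr :: "fmat \<Rightarrow> real" where
  "rtr a = Re (tr a)"

lemma tr_eq:
  assumes "supp_below N a"
  shows "tr a = (\<Sum>i<N. entry a i i)"
  unfolding tr_def using assms
  by (intro sum.mono_neutral_left) (auto simp: supp_below_def not_le[symmetric])

lemma tr_zero [simp]: "tr 0 = 0"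
  by (simp add: tr_def)

lemma tr_add: "tr (a + b) = tr a + tr b"
proof -
  obtain N where N: "supp_below N a" "supp_below N b" "supp_below N (a + b)"
    using supp_below_exists3 by blast
  then show ?thesis by (simp add: tr_eq[of N] sum.distrib)
qed

lemma tr_diff: "tr (a - b) = tr a - tr b"
proof -
  obtain N where N: "supp_below N a" "supp_below N b" "supp_below N (a - b)"
    using supp_below_exists3 by blast
  then show ?thesis by (simp add: tr_eq[of N] sum_subtractf)
qed

lemma tr_smul: "tr (c *\<^sub>C a) = c * tr a"
proof -
  obtain N where N: "supp_below N a" "supp_below N (c *\<^sub>C a)"
    using supp_below_exists2 by blast
  then show ?thesis using tr_eq[OF N(1)] tr_eq[OF N(2)] by (simp add: sum_distrib_left)
qed

lemma tr_sum: "tr (\<Sum>i\<in>S. f i) = (\<Sum>i\<in>S. tr (f i))"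
  by (induction S rule: infinite_finite_induct) (auto simp: tr_add)

lemma tr_mult_commute: "tr (a * b) = tr (b * a)"
proof -
  obtain N where N: "supp_below N a" "supp_below N b" using supp_below_exists2 by blast
  have "tr (a * b) = (\<Sum>i<N. \<Sum>k<N. entry a i k * entry b k i)"
    using N supp_below_times[of N a b] by (simp add: tr_eq[of N] entry_times[of N])
  also have "\<dots> = (\<Sum>k<N. \<Sum>i<N. entry a i k * entry b k i)" by (rule sum.swap)
  also have "\<dots> = tr (b * a)"
    using N supp_below_times[of N b a] by (simp add: tr_eq[of N] entry_times[of N] mult.commute)
  finally show ?thesis .
qed

lemma rtr_zero [simp]: "rtr 0 = 0"
  and rtr_diff: "rtr (a - b) = rtr a - rtr b"
  and rtr_mult_commute: "rtr (a * b) = rtr (b * a)"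
  and rtr_sum: "rtr (\<Sum>i\<in>S. f i) = (\<Sum>i\<in>S. rtr (f i))"
  by (simp_all add: rtr_def tr_diff tr_sum tr_mult_commute[of a b])

lemma tr_adj_mult_self:
  assumes "supp_below N a"
  shows "tr (adj a * a) = of_real (\<Sum>i<N. \<Sum>k<N. (cmod (entry a k i))\<^sup>2)"
proof -
  have "tr (adj a * a) = (\<Sum>i<N. \<Sum>k<N. cnj (entry a k i) * entry a k i)"
    using assms supp_below_adj[OF assms] supp_below_times[of N "adj a" a]
    by (simp add: tr_eq[of N] entry_times[of N])
  also have "\<dots> = (\<Sum>i<N. \<Sum>k<N. of_real ((cmod (entry a k i))\<^sup>2))"
    by (simp only: complex_norm_square mult.commute)
  finally show ?thesis by simp
qed

lemma rtr_adj_mult_nonneg: "0 \<le> rtr (adj a * a)"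
proof -
  obtain N where "supp_below N a" using supp_below_exists by blast
  from tr_adj_mult_self[OF this] show ?thesis
    unfolding rtr_def by (simp add: sum_nonneg)
qed

lemma tr_adj_mult_eq_0:
  assumes "tr (adj a * a) = 0"
  shows "a = 0"
proof -
  obtain N where N: "supp_below N a" using supp_below_exists by blast
  have "complex_of_real (\<Sum>i<N. \<Sum>k<N. (cmod (entry a k i))\<^sup>2) = 0"
    using tr_adj_mult_self[OF N] assms by simp
  then have "(\<Sum>i<N. \<Sum>k<N. (cmod (entry a k i))\<^sup>2) = 0"
    by (simp only: of_real_eq_0_iff)
  then have z: "\<And>i k. i < N \<Longrightarrow> k < N \<Longrightarrow> entry a k i = 0"
    by (simp add: sum_nonneg_eq_0_iff sum_nonneg)
  show ?thesis
  proof (rule fmat_eqI)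
    fix i j show "entry a i j = entry 0 i j"
      using z[of j i] N by (cases "i < N \<and> j < N") (auto simp: supp_below_def)
  qed
qed

lemma adj_mult_eq_0: "adj a * a = 0 \<longleftrightarrow> a = 0"
  using tr_adj_mult_eq_0 by fastforce

section \<open>Projections\<close>

definition proj :: "fmat \<Rightarrow> bool" where
  "proj e \<longleftrightarrow> adj e = e \<and> e * e = e"

lemma projD: "proj e \<Longrightarrow> adj e = e" "proj e \<Longrightarrow> e * e = e" "proj e \<Longrightarrow> e * (e * a) = e * a"
  by (auto simp: proj_def mult.assoc[symmetric])

lemma proj_zero [simp]: "proj 0"
  by (simp add: proj_def)

lemma rtr_proj_nonneg: "proj e \<Longrightarrow> 0 \<le> rtr e"
  using rtr_adj_mult_nonneg[of e] by (simp add: proj_def)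

lemma proj_absorb_swap: "proj e \<Longrightarrow> proj f \<Longrightarrow> e * f = f \<Longrightarrow> f * e = f"
  by (metis adj_mult projD(1))

lemma proj_diff: "proj e \<Longrightarrow> proj f \<Longrightarrow> e * f = f \<Longrightarrow> proj (e - f)"
  using proj_absorb_swap[of e f] by (simp add: proj_def right_diff_distrib left_diff_distrib)

lemma rtr_proj_mono: "proj e \<Longrightarrow> proj f \<Longrightarrow> e * f = f \<Longrightarrow> rtr f \<le> rtr e"
  using rtr_proj_nonneg[OF proj_diff, of e f] by (simp add: rtr_diff)

lift_definition matrix_unit :: "nat \<Rightarrow> nat \<Rightarrow> fmat" is "\<lambda>p q i j. if i = p \<and> j = q then 1 else 0"
proof -
  fix p q :: nat
  show "\<exists>N. \<forall>i j. N \<le> i \<or> N \<le> j \<longrightarrow> (if i = p \<and> j = q then 1 else 0) = (0::complex)"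
    by (rule exI[of _ "Suc (max p q)"]) auto
qed

lemma entry_matrix_unit: "entry (matrix_unit p q) i j = (if i = p \<and> j = q then 1 else 0)"
  by (simp add: matrix_unit.rep_eq)

lemma supp_below_matrix_unit: "supp_below (Suc (max p q)) (matrix_unit p q)"
  by (auto simp: supp_below_def entry_matrix_unit)

lemma entry_matrix_unit_times: "entry (matrix_unit p q * a) i j = (if i = p then entry a q j else 0)"
  by (simp add: entry_times[OF supp_below_matrix_unit] entry_matrix_unit if_distrib[of "\<lambda>x. x * _"] cong: if_cong)

lemma entry_times_matrix_unit: "entry (a * matrix_unit p q) i j = (if j = q then entry a i p else 0)"
proof -
  obtain N where N: "supp_below N a" "p < N"
    using supp_below_exists[of a] supp_below_mono
    by (metis lessI less_le_trans max.cobounded1 max.cobounded2)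
  then show ?thesis
    by (simp add: entry_times[of N] entry_matrix_unit if_distrib[of "\<lambda>x. _ * x"] cong: if_cong)
qed

lemma adj_matrix_unit: "adj (matrix_unit p q) = matrix_unit q p"
  by (rule fmat_eqI) (auto simp: entry_matrix_unit)

lemma proj_matrix_unit: "proj (matrix_unit p p)"
  by (auto simp: proj_def adj_matrix_unit entry_matrix_unit entry_matrix_unit_times intro!: fmat_eqI)

lemma rtr_matrix_unit: "rtr (matrix_unit p p) = 1"
proof -
  have "tr (matrix_unit p p) = (\<Sum>i<Suc p. if i = p then 1 else 0)"
    using supp_below_matrix_unit[of p p] by (simp only: tr_eq max.idem entry_matrix_unit) simp
  then show ?thesis by (simp add: rtr_def)
qed

text \<open>
  The element \<open>c\<close> stands for a unit vector in the range of \<open>e\<close>, stored as a matrix whose only nonzero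
  column is the first one: a column of \<open>e\<close> with nonzero norm, rescaled. Since \<open>adj c * c\<close> does not
  depend on \<open>e\<close>, unit vectors of unrelated projections can be composed to partial isometries.
\<close>

lemma proj_unit_column:
  assumes "proj e" "e \<noteq> 0"
  obtains c where "e * c = c" "adj c * c = matrix_unit 0 0"
proof -
  obtain i p where ne: "entry e i p \<noteq> 0" using assms(2) fmat_eqI[of e 0] by auto
  obtain N where N: "supp_below N e" using supp_below_exists by blast
  define s where "s = (\<Sum>k<N. (cmod (entry e k p))\<^sup>2)"
  have iN: "i < N" using N ne by (auto simp: supp_below_def not_le[symmetric])
  have "entry (adj e * e) p p = (\<Sum>k<N. cnj (entry e k p) * entry e k p)"
    using supp_below_adj[OF N] by (simp add: entry_times[of N])
  also have "\<dots> = (\<Sum>k<N. of_real ((cmod (entry e k p))\<^sup>2))"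
    by (simp only: complex_norm_square mult.commute)
  finally have epp: "entry e p p = of_real s" using assms(1) by (simp add: s_def proj_def)
  have s: "s > 0" unfolding s_def
    by (rule sum_pos2[of _ i]) (use iN ne in auto)
  define c where "c = (1 / of_real (sqrt s)) *\<^sub>C (e * matrix_unit p 0)"
  have 1: "e * c = c" using assms(1) by (simp add: c_def projD)
  have a: "adj (e * matrix_unit p 0) * (e * matrix_unit p 0) = matrix_unit 0 p * (e * matrix_unit p 0)"
    using assms(1) by (simp add: adj_matrix_unit projD mult.assoc)
  have "adj c * c = (1 / of_real s) *\<^sub>C (matrix_unit 0 p * (e * matrix_unit p 0))"
    using s unfolding c_def adj_smul smul_mult_left smul_mult_right a fmat.scale_scale
    by (simp add: of_real_mult[symmetric] del: of_real_mult)
  also have "\<dots> = matrix_unit 0 0"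
    using s by (intro fmat_eqI) (auto simp: entry_matrix_unit_times entry_times_matrix_unit entry_matrix_unit epp)
  finally have 2: "adj c * c = matrix_unit 0 0" .
  show ?thesis using 1 2 by (rule that)
qed

lemma unit_column_times:
  assumes "adj c * c = matrix_unit 0 0"
  shows "c * matrix_unit 0 0 = c"
proof -
  have "adj (c * matrix_unit 0 0 - c) * (c * matrix_unit 0 0 - c) = 0"
    using projD[OF proj_matrix_unit[of 0]]
    by (simp add: adj_matrix_unit right_diff_distrib left_diff_distrib mult.assoc
        assms mult.assoc[of "adj c" c, symmetric])
  then show ?thesis by (simp only: adj_mult_eq_0 right_minus_eq)
qed

text \<open>
  The rank-one projection onto a unit vector in the range of \<open>e\<close> lies below \<open>e\<close>. This substitutes for
  integrality of the rank: it makes every process that lowers the trace of projections terminate.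
\<close>

lemma rtr_proj_ge_1:
  assumes "proj e" "e \<noteq> 0"
  shows "1 \<le> rtr e"
proof -
  obtain c where c: "e * c = c" "adj c * c = matrix_unit 0 0" using proj_unit_column[OF assms] .
  have "c * adj c * (c * adj c) = c * matrix_unit 0 0 * adj c" by (simp add: c(2)[symmetric] mult.assoc)
  then have "proj (c * adj c)" by (simp add: proj_def unit_column_times[OF c(2)])
  moreover have "e * (c * adj c) = c * adj c" by (simp add: mult.assoc[symmetric] c(1))
  ultimately have "rtr (c * adj c) \<le> rtr e" by (rule rtr_proj_mono[OF assms(1)])
  then show ?thesis using rtr_mult_commute[of c "adj c"] by (simp add: c(2) rtr_matrix_unit)
qed

lemma tr_proj: "proj e \<Longrightarrow> tr e = of_real (rtr e)"
proof -
  assume e: "proj e"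
  obtain N where "supp_below N e" using supp_below_exists by blast
  from tr_adj_mult_self[OF this] show ?thesis using e by (simp add: rtr_def projD)
qed

lemma proj_sum_orth:
  assumes "finite R" "\<And>i. i \<in> R \<Longrightarrow> proj (f i)"
    and "\<And>i j. i \<in> R \<Longrightarrow> j \<in> R \<Longrightarrow> i \<noteq> j \<Longrightarrow> f i * f j = 0"
  shows "proj (\<Sum>i\<in>R. f i)"
proof -
  have "(\<Sum>i\<in>R. f i) * (\<Sum>i\<in>R. f i) = (\<Sum>i\<in>R. \<Sum>j\<in>R. f i * f j)"
    by (simp add: sum_product)
  also have "\<dots> = (\<Sum>i\<in>R. \<Sum>j\<in>R. if j = i then f i else 0)"
    using assms(2,3) by (intro sum.cong refl) (auto simp: projD)
  also have "\<dots> = (\<Sum>i\<in>R. f i)" using assms(1) by simp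
  finally show ?thesis using assms(2) by (simp add: proj_def adj_sum)
qed

lemma rtr_sum_orth_le:
  assumes "finite R" "\<And>i. i \<in> R \<Longrightarrow> proj (f i)"
    and "\<And>i j. i \<in> R \<Longrightarrow> j \<in> R \<Longrightarrow> i \<noteq> j \<Longrightarrow> f i * f j = 0"
    and "proj e" "\<And>i. i \<in> R \<Longrightarrow> e * f i = f i"
  shows "(\<Sum>i\<in>R. rtr (f i)) \<le> rtr e"
proof -
  have "rtr (\<Sum>i\<in>R. f i) \<le> rtr e"
    using assms by (intro rtr_proj_mono proj_sum_orth) (auto simp: sum_distrib_left)
  then show ?thesis by (simp add: rtr_sum)
qed

section \<open>Spectral projections in a corner\<close>

text \<open>
  Polynomial evaluation in a corner: the constant term is multiplied by the unit \<open>e\<close> of the corner.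
\<close>

definition peval :: "fmat \<Rightarrow> fmat \<Rightarrow> complex poly \<Rightarrow> fmat" where
  "peval e a p = fold_coeffs (\<lambda>c x. c *\<^sub>C e + a * x) p 0"

lemma peval_0 [simp]: "peval e a 0 = 0"
  by (simp add: peval_def)

lemma peval_pCons [simp]: "peval e a (pCons c p) = c *\<^sub>C e + a * peval e a p"
  by (cases "p = 0 \<and> c = 0") (auto simp: peval_def)

lemma peval_add: "peval e a (p + q) = peval e a p + peval e a q"
  by (induction p q rule: poly_induct2) (auto simp: algebra_simps fmat.scale_left_distrib)

lemma peval_smult: "peval e a (smult c p) = c *\<^sub>C peval e a p"
  by (induction p) (auto simp: fmat.scale_right_distrib)

lemma peval_diff: "peval e a (p - q) = peval e a p - peval e a q"
  using peval_add[of e a "p - q" q] by (simp add: algebra_simps)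

lemma peval_sum: "peval e a (\<Sum>i\<in>S. f i) = (\<Sum>i\<in>S. peval e a (f i))"
  by (induction S rule: infinite_finite_induct) (auto simp: peval_add)

locale corner_element =
  fixes e a :: fmat
  assumes proj_e: "proj e" and ea: "e * a = a" and ae: "a * e = a"
begin

lemma e_peval: "e * peval e a p = peval e a p"
  by (induction p) (auto simp: distrib_left projD[OF proj_e] mult.assoc[symmetric] ea)

lemma peval_mult: "peval e a (p * q) = peval e a p * peval e a q"
  by (induction p) (auto simp: distrib_right mult.assoc peval_add peval_smult e_peval)

lemma peval_commute: "peval e a p * peval e a q = peval e a q * peval e a p"
  by (metis peval_mult mult.commute)

lemma peval_gen_commute: "a * peval e a p = peval e a p * a"
  using peval_commute[of "[:0, 1:]" p] by (simp add: ae)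

lemma peval_adj:
  assumes "adj a = a"
  shows "adj (peval e a p) = peval e a (map_poly cnj p)"
proof (induction p)
  case (pCons c p)
  then show ?case
    using assms by (simp add: map_poly_pCons projD[OF proj_e] peval_gen_commute)
qed simp

lemma peval_eigen:
  assumes "a * g = l *\<^sub>C g" "e * g = g"
  shows "peval e a p * g = poly p l *\<^sub>C g"
  by (induction p) (auto simp: assms distrib_right mult.assoc fmat.scale_left_distrib mult.commute)

lemma peval_supp_below:
  assumes "supp_below N e" "supp_below N a"
  shows "supp_below N (peval e a p)"
proof (induction p)
  case (pCons c p)
  have "supp_below N (a * peval e a p)" using supp_below_times[OF assms(2) pCons.IH] .
  then show ?case using assms(1) by (simp add: supp_below_def)
qed (simp add: supp_below_def)

end

text \<open>
  Corners are finite-dimensional, which is where annihilating polynomials come from.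
\<close>

lemma supp_below_span:
  assumes "supp_below N x"
  shows "x \<in> fmat.span ((\<lambda>(i, j). matrix_unit i j) ` ({..<N} \<times> {..<N}))"
proof -
  have "x = (\<Sum>(i, j)\<in>{..<N} \<times> {..<N}. entry x i j *\<^sub>C matrix_unit i j)"
  proof (rule fmat_eqI)
    fix p q
    have entry_sum: "entry (\<Sum>k\<in>S. f k) p q = (\<Sum>k\<in>S. entry (f k) p q)"
      for f :: "nat \<times> nat \<Rightarrow> fmat" and S
      by (induction S rule: infinite_finite_induct) auto
    have "entry (\<Sum>(i, j)\<in>{..<N} \<times> {..<N}. entry x i j *\<^sub>C matrix_unit i j) p q
      = (\<Sum>k\<in>{..<N} \<times> {..<N}. if k = (p, q) then entry x p q else 0)"
      unfolding entry_sum by (intro sum.cong) (auto simp: entry_matrix_unit split: if_splits)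
    also have "\<dots> = entry x p q"
      using assms by (auto simp: supp_below_def not_less)
    finally show "entry x p q
      = entry (\<Sum>(i, j)\<in>{..<N} \<times> {..<N}. entry x i j *\<^sub>C matrix_unit i j) p q" by simp
  qed
  also have "\<dots> \<in> fmat.span ((\<lambda>(i, j). matrix_unit i j) ` ({..<N} \<times> {..<N}))"
    unfolding split_def by (intro fmat.span_sum fmat.span_scale fmat.span_base) auto
  finally show ?thesis .
qed

context corner_element
begin

lemma annihilating_poly_exists: "\<exists>q. q \<noteq> 0 \<and> peval e a q = 0"
proof -
  obtain N where N: "supp_below N e" "supp_below N a" using supp_below_exists2 by blast
  define T where "T = (\<lambda>(i, j). matrix_unit i j) ` ({..<N} \<times> {..<N})"
  define P where "P i = peval e a (monom 1 i)" for i
  have T: "finite T" "card T \<le> N * N"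
    unfolding T_def using card_image_le[of "{..<N} \<times> {..<N}" "\<lambda>(i, j). matrix_unit i j"] by auto
  show ?thesis
  proof (cases "inj P")
    case False
    then obtain i j where "i \<noteq> j" "P i = P j" by (auto simp: inj_def)
    then show ?thesis
      by (intro exI[of _ "monom 1 i - monom 1 j"]) (auto simp: peval_diff P_def monom_eq_iff')
  next
    case True
    define S where "S = P ` {..N * N}"
    have fin: "finite S" by (simp add: S_def)
    have sub: "S \<subseteq> fmat.span T"
      unfolding S_def T_def P_def using supp_below_span[OF peval_supp_below[OF N]] by auto
    have "card S = N * N + 1"
      unfolding S_def using True by (simp add: card_image inj_on_subset)
    then have "fmat.dependent S"
      using fmat.independent_span_bound[OF T(1) _ sub] T(2) by auto
    then obtain u v where uv: "v \<in> S" "u v \<noteq> 0" "(\<Sum>v\<in>S. u v *\<^sub>C v) = 0"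
      unfolding fmat.dependent_finite[OF fin] by blast
    define q where "q = (\<Sum>i\<le>N * N. monom (u (P i)) i)"
    obtain j where j: "j \<le> N * N" "v = P j" using uv(1) by (auto simp: S_def)
    have "coeff q j = u (P j)" using j by (simp add: q_def coeff_sum)
    with uv j have "q \<noteq> 0" by auto
    moreover have "peval e a q = (\<Sum>i\<le>N * N. peval e a (smult (u (P i)) (monom 1 i)))"
      by (simp add: q_def peval_sum smult_monom)
    then have "peval e a q = (\<Sum>i\<le>N * N. u (P i) *\<^sub>C P i)"
      by (simp only: peval_smult P_def)
    then have "peval e a q = (\<Sum>v\<in>S. u v *\<^sub>C v)"
      unfolding S_def using True by (subst sum.reindex) (auto intro: inj_on_subset)
    ultimately show ?thesis using uv(3) by auto
  qed
qed

lemma min_poly_exists: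
  obtains q where "q \<noteq> 0" "peval e a q = 0"
    "\<And>p. p \<noteq> 0 \<Longrightarrow> peval e a p = 0 \<Longrightarrow> degree q \<le> degree p"
  using annihilating_poly_exists
    ex_has_least_nat[of "\<lambda>q. q \<noteq> 0 \<and> peval e a q = 0" _ degree] by metis

text \<open>
  Self-adjoint elements are diagonalisable. For a root \<open>l\<close> of the minimal polynomial \<open>q\<close>, put
  \<open>G = g(a)\<close> with \<open>q = (X - l) * g\<close>. Then \<open>a * G = l *\<^sub>C G\<close>, so every polynomial in \<open>a\<close>, in
  particular \<open>G\<close> and its adjoint, acts on \<open>G\<close> as a scalar. As \<open>adj G * G \<noteq> 0\<close>, these scalars are nonzero:
  a multiple of \<open>G\<close> is a projection, and \<open>g\<close> does not vanish at \<open>l\<close>, so the root is simple.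
\<close>

lemma root_projection:
  assumes sa: "adj a = a"
    and q: "q \<noteq> 0" "peval e a q = 0"
    and min: "\<And>p. p \<noteq> 0 \<Longrightarrow> peval e a p = 0 \<Longrightarrow> degree q \<le> degree p"
    and root: "poly q l = 0"
  shows "poly (pderiv q) l \<noteq> 0"
    and "\<exists>p. degree p + 1 = degree q \<and> proj (peval e a p) \<and> peval e a p \<noteq> 0
           \<and> a * peval e a p = l *\<^sub>C peval e a p"
proof -
  obtain g where g: "q = [:-l, 1:] * g" using root by (auto simp: poly_eq_0_iff_dvd)
  have g0: "g \<noteq> 0" using g q(1) by auto
  have dg: "degree g + 1 = degree q" unfolding g using g0 by (subst degree_mult_eq) auto
  define G where "G = peval e a g"
  have G0: "G \<noteq> 0" using min[OF g0] dg by (auto simp: G_def)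
  have eG: "e * G = G" by (simp add: G_def e_peval)
  have "peval e a [:-l, 1:] * G = 0"
    using q(2) unfolding g peval_mult G_def .
  then have aG: "a * G = l *\<^sub>C G" by (simp add: ae left_diff_distrib distrib_right eG)
  define c where "c = poly (map_poly cnj g) l"
  have 1: "adj G * G = c *\<^sub>C G"
    unfolding c_def using peval_eigen[OF aG eG] peval_adj[OF sa] by (simp add: G_def)
  have c0: "c \<noteq> 0" using 1 G0 adj_mult_eq_0[of G] by auto
  have "adj (adj G * G) = adj G * G" by simp
  then have 2: "c *\<^sub>C G = cnj c *\<^sub>C adj G" unfolding 1 by simp
  \<comment> \<open>Up to a scalar of modulus 1, \<open>G\<close> is self-adjoint.\<close>
  then have adjG: "adj G = (c / cnj c) *\<^sub>C G"
    using c0 by (metis (no_types) complex_cnj_zero_iff fmat.scale_scale fmat.scale_one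
        nonzero_divide_eq_eq divide_inverse mult.commute right_inverse)
  have "(c / cnj c) *\<^sub>C (G * G) = c *\<^sub>C G" using 1 unfolding adjG by simp
  then have "(cnj c / c) *\<^sub>C (c / cnj c) *\<^sub>C (G * G) = (cnj c / c) *\<^sub>C c *\<^sub>C G" by simp
  then have GG: "G * G = cnj c *\<^sub>C G" using c0 by simp
  have "poly g l *\<^sub>C G = cnj c *\<^sub>C G"
    using peval_eigen[OF aG eG, of g] GG by (simp add: G_def)
  then have "poly g l = cnj c" using G0 by (simp add: fmat.scale_right_imp_eq)
  then show "poly (pderiv q) l \<noteq> 0" using c0 
    unfolding g pderiv_mult by (simp add: pderiv_pCons del: mult_pCons_left mult_pCons_right)
  define p where "p = smult (1 / cnj c) g"
  have p: "peval e a p = (1 / cnj c) *\<^sub>C G" by (simp add: p_def peval_smult G_def)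
  have "proj (peval e a p)" unfolding p proj_def using c0 by (simp add: adjG GG)
  moreover have "peval e a p \<noteq> 0" unfolding p using c0 G0 by simp
  moreover have "a * peval e a p = l *\<^sub>C peval e a p" unfolding p by (simp add: aG mult.commute)
  moreover have "degree p + 1 = degree q" using dg c0 by (simp add: p_def)
  ultimately show "\<exists>p. degree p + 1 = degree q \<and> proj (peval e a p) \<and> peval e a p \<noteq> 0
           \<and> a * peval e a p = l *\<^sub>C peval e a p" by blast
qed

text \<open>
  The minimal polynomial has as many roots as its degree, and the spectral projections are
  orthogonal, so the one with the smallest trace has at most the average trace. Its degree as a
  polynomial in \<open>a\<close> is one less than the number by which the trace is divided.
\<close>

lemma small_spectral_projection:
  assumes sa: "adj a = a" and nonscalar: "\<And>c. a \<noteq> c *\<^sub>C e"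
  obtains p where "1 \<le> degree p" "proj (peval e a p)" "peval e a p \<noteq> 0"
    "real (degree p + 1) * rtr (peval e a p) \<le> rtr e"
proof -
  obtain q where q: "q \<noteq> 0" "peval e a q = 0"
    and min: "\<And>p. p \<noteq> 0 \<Longrightarrow> peval e a p = 0 \<Longrightarrow> degree q \<le> degree p"
    using min_poly_exists by blast
  have e0: "e \<noteq> 0" using nonscalar[of 0] ea by auto
  have d2: "2 \<le> degree q"
  proof (rule ccontr)
    assume "\<not> ?thesis"
    then have d: "degree q \<le> 1" by simp
    obtain u v where uv: "q = [:u, v:]"
      using degree1_coeffs d degree_eq_zeroE by (metis le_antisym less_one not_less pCons_0_0 pCons_eq_iff)
    have z: "u *\<^sub>C e + v *\<^sub>C a = 0" using q(2) by (simp add: uv ae distrib_left)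
    show False
    proof (cases "v = 0")
      case True
      then show False using z q(1) e0 by (simp add: uv)
    next
      case False
      have "(1 / v) *\<^sub>C (u *\<^sub>C e + v *\<^sub>C a) = 0" by (simp add: z)
      then have "(u / v) *\<^sub>C e + a = 0" using False by (simp add: fmat.scale_right_distrib)
      then have "a = (- (u / v)) *\<^sub>C e"
        by (metis fmat.scale_minus_left add.commute eq_neg_iff_add_eq_0)
      then show False using nonscalar by blast
    qed
  qed
  define R where "R = {l. poly q l = 0}"
  have finR: "finite R" using q(1) by (simp add: R_def poly_roots_finite)
  note rp = root_projection[OF sa q min]
  have "rsquarefree q" unfolding rsquarefree_roots using rp(1) by blast
  then have dec: "smult (lead_coeff q) (\<Prod>z\<in>R. [:-z, 1:]) = q"
    unfolding R_def by (rule complex_poly_decompose_rsquarefree)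
  have "degree q = degree (\<Prod>z\<in>R. [:-z, 1:])"
    using q(1) by (metis dec degree_smult_eq leading_coeff_0_iff)
  also have "\<dots> = card R" by (subst degree_prod_eq_sum_degree) auto
  finally have dR: "degree q = card R" .
  obtain P where P: "\<And>l. l \<in> R \<Longrightarrow> degree (P l) + 1 = degree q"
    "\<And>l. l \<in> R \<Longrightarrow> proj (peval e a (P l))" "\<And>l. l \<in> R \<Longrightarrow> peval e a (P l) \<noteq> 0"
    "\<And>l. l \<in> R \<Longrightarrow> a * peval e a (P l) = l *\<^sub>C peval e a (P l)"
    using rp(2) unfolding R_def mem_Collect_eq by metis
  have orth: "peval e a (P l) * peval e a (P m) = 0" if "l \<in> R" "m \<in> R" "l \<noteq> m" for l m
  proof -
    have "l *\<^sub>C (peval e a (P l) * peval e a (P m)) = a * peval e a (P l) * peval e a (P m)"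
      by (simp add: P(4)[OF that(1)])
    also have "\<dots> = peval e a (P l) * (a * peval e a (P m))"
      by (simp add: peval_gen_commute mult.assoc)
    also have "\<dots> = m *\<^sub>C (peval e a (P l) * peval e a (P m))"
      by (simp add: P(4)[OF that(2)])
    finally show ?thesis using that(3) fmat.scale_right_imp_eq by blast
  qed
  have le: "(\<Sum>l\<in>R. rtr (peval e a (P l))) \<le> rtr e"
    by (rule rtr_sum_orth_le[OF finR P(2) orth proj_e]) (auto simp: e_peval)
  have "\<exists>l\<in>R. real (card R) * rtr (peval e a (P l)) \<le> rtr e"
  proof (rule ccontr)
    assume "\<not> ?thesis"
    then have "(\<Sum>l\<in>R. rtr e) < (\<Sum>l\<in>R. real (card R) * rtr (peval e a (P l)))"
      using finR dR d2 by (intro sum_strict_mono) auto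
    also have "\<dots> \<le> real (card R) * rtr e"
      using le by (simp add: sum_distrib_left[symmetric] mult_left_mono)
    finally show False by simp
  qed
  then obtain l where l: "l \<in> R" "real (card R) * rtr (peval e a (P l)) \<le> rtr e" by blast
  have "degree (P l) + 1 = card R" using P(1)[OF l(1)] dR by simp
  then show ?thesis using that[of "P l"] l P(2,3)[OF l(1)] d2 dR by simp
qed

end

section \<open>Words and their spans\<close>

fun gen :: "fmat \<Rightarrow> letter \<Rightarrow> fmat" where
  "gen D Lx = D"
| "gen D Ly = adj D"

fun weval :: "fmat \<Rightarrow> fmat \<Rightarrow> letter list \<Rightarrow> fmat" where
  "weval I D [] = I"
| "weval I D (x # w) = gen D x * weval I D w"

definition words_span :: "fmat \<Rightarrow> fmat \<Rightarrow> nat \<Rightarrow> fmat set" where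
  "words_span I D k = fmat.span (weval I D ` {w. length w \<le> k})"

fun swap_letter :: "letter \<Rightarrow> letter" where
  "swap_letter Lx = Ly"
| "swap_letter Ly = Lx"

lemma adj_gen: "adj (gen D x) = gen D (swap_letter x)"
  by (cases x) auto

text \<open>
  Together with \<open>V_induct\<close> below, the next three facts reduce closure properties of spans of words
  to the words themselves.
\<close>

lemma subspace_vimage_mult_left: "fmat.subspace W \<Longrightarrow> fmat.subspace {x. x * y \<in> W}"
  by (auto simp: fmat.subspace_def distrib_right)

lemma subspace_vimage_mult_right: "fmat.subspace W \<Longrightarrow> fmat.subspace {x. y * x \<in> W}"
  by (auto simp: fmat.subspace_def distrib_left)

lemma subspace_vimage_adj: "fmat.subspace W \<Longrightarrow> fmat.subspace {x. adj x \<in> W}"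
  by (auto simp: fmat.subspace_def)

text \<open>
  The projection \<open>I\<close> is the unit of the algebra generated by \<open>D\<close> and its adjoint, and the value of the
  empty word. Letting \<open>I\<close> vary is what allows to cut the algebra down to an invariant subspace.
\<close>

locale unital_generator =
  fixes I D :: fmat
  assumes proj_I: "proj I" and ID: "I * D = D" and DI: "D * I = D"
begin

abbreviation V :: "nat \<Rightarrow> fmat set" where
  "V \<equiv> words_span I D"

lemma I_gen: "I * gen D x = gen D x" and gen_I: "gen D x * I = gen D x"
  using proj_I ID DI by (cases x; metis adj_mult gen.simps projD(1))+

lemma I_weval: "I * weval I D w = weval I D w"
  by (cases w) (auto simp: projD[OF proj_I] mult.assoc[symmetric] I_gen)

lemma weval_I: "weval I D w * I = weval I D w"
  by (induction w) (auto simp: projD[OF proj_I] mult.assoc)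

lemma weval_append: "weval I D (u @ w) = weval I D u * weval I D w"
  by (induction u) (auto simp: mult.assoc I_weval)

lemma adj_weval: "adj (weval I D w) = weval I D (rev (map swap_letter w))"
  by (induction w) (auto simp: projD[OF proj_I] weval_append adj_gen gen_I)

lemma subspace_V: "fmat.subspace (V k)"
  by (simp add: words_span_def)

lemmas V_add = fmat.subspace_add[OF subspace_V]
  and V_diff = fmat.subspace_diff[OF subspace_V]
  and V_smul = fmat.subspace_scale[OF subspace_V]
  and V_sum = fmat.subspace_sum[OF subspace_V]

lemma V_weval: "length w \<le> k \<Longrightarrow> weval I D w \<in> V k"
  unfolding words_span_def by (rule fmat.span_base) auto

lemma V_I: "I \<in> V k"
  using V_weval[of "[]"] by simp

lemma V_gen: "gen D x \<in> V 1"
  using V_weval[of "[x]" 1] by (simp add: gen_I)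

lemma V_mono: "x \<in> V j \<Longrightarrow> j \<le> k \<Longrightarrow> x \<in> V k"
  unfolding words_span_def
  by (rule subsetD[OF fmat.span_mono, of "weval I D ` {w. length w \<le> j}"]) auto

lemma V_induct:
  assumes "x \<in> V k" "fmat.subspace W" "\<And>w. length w \<le> k \<Longrightarrow> weval I D w \<in> W"
  shows "x \<in> W"
  using assms fmat.span_minimal[of "weval I D ` {w. length w \<le> k}" W]
  unfolding words_span_def by auto

lemma V_mult:
  assumes x: "x \<in> V j" and y: "y \<in> V k"
  shows "x * y \<in> V (j + k)"
proof -
  have "weval I D u * y \<in> V (j + k)" if "length u \<le> j" for u
  proof -
    have "y \<in> {y. weval I D u * y \<in> V (j + k)}"
      using that by (intro V_induct[OF y] subspace_vimage_mult_right subspace_V)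
        (auto simp: weval_append[symmetric] intro!: V_weval)
    then show ?thesis by simp
  qed
  then have "x \<in> {x. x * y \<in> V (j + k)}"
    by (intro V_induct[OF x] subspace_vimage_mult_left subspace_V) auto
  then show ?thesis by simp
qed

lemma V_adj: "x \<in> V k \<Longrightarrow> adj x \<in> V k"
proof -
  assume x: "x \<in> V k"
  have "x \<in> {x. adj x \<in> V k}"
    by (intro V_induct[OF x] subspace_vimage_adj subspace_V) (auto simp: adj_weval intro!: V_weval)
  then show ?thesis by simp
qed

lemma I_V: "x \<in> V k \<Longrightarrow> I * x = x" and V_I_right: "x \<in> V k \<Longrightarrow> x * I = x"
proof -
  assume x: "x \<in> V k"
  have "x \<in> {x. I * x = x}"
    by (intro V_induct[OF x]) (auto simp: fmat.subspace_def distrib_left I_weval)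
  then show "I * x = x" by simp
  have "x \<in> {x. x * I = x}"
    by (intro V_induct[OF x]) (auto simp: fmat.subspace_def distrib_right weval_I)
  then show "x * I = x" by simp
qed

end

section \<open>Systems of isometric copies of a projection\<close>

text \<open>
  The \<open>S i\<close> are partial isometries from the range of \<open>e\<close> onto pairwise orthogonal subspaces, so the
  \<open>S i * adj (S j)\<close> multiply like matrix units and \<open>range_proj\<close> is the unit of the matrix
  algebra they span.
\<close>

locale isometric_system =
  fixes e :: fmat and d :: nat and S :: "nat \<Rightarrow> fmat"
  assumes proj_e: "proj e"
    and S_e: "i < d \<Longrightarrow> S i * e = S i"
    and S_orth: "i < d \<Longrightarrow> j < d \<Longrightarrow> adj (S i) * S j = (if i = j then e else 0)"
begin

definition range_proj :: fmat where
  "range_proj = (\<Sum>i<d. S i * adj (S i))"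

lemma range_proj_S: "i < d \<Longrightarrow> range_proj * S i = S i"
  by (simp add: range_proj_def sum_distrib_right mult.assoc S_orth S_e if_distrib cong: if_cong)

lemma S_range_proj: "i < d \<Longrightarrow> adj (S i) * range_proj = adj (S i)"
proof -
  assume "i < d"
  then have "adj (range_proj * S i) = adj (S i)" by (simp add: range_proj_S)
  then show ?thesis by (simp add: range_proj_def adj_sum)
qed

lemma proj_summand: "i < d \<Longrightarrow> proj (S i * adj (S i))"
  unfolding proj_def by (simp add: mult.assoc[of _ "adj (S i)"] mult.assoc[of "adj (S i)", symmetric] S_orth)
    (simp add: mult.assoc[symmetric] S_e)

lemma summand_orth: "i < d \<Longrightarrow> j < d \<Longrightarrow> i \<noteq> j \<Longrightarrow> S i * adj (S i) * (S j * adj (S j)) = 0"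
  by (metis (no_types) S_orth mult.assoc mult_zero_left mult_zero_right)

lemma rtr_summand: "i < d \<Longrightarrow> rtr (S i * adj (S i)) = rtr e"
  using rtr_mult_commute[of "S i" "adj (S i)"] by (simp add: S_orth)

lemma proj_range_proj: "proj range_proj"
  unfolding range_proj_def by (rule proj_sum_orth) (auto simp: proj_summand summand_orth)

lemma rtr_range_proj: "rtr range_proj = real d * rtr e"
  unfolding range_proj_def by (simp add: rtr_sum rtr_summand)

lemma rtr_bound:
  assumes "proj f" "\<And>i. i < d \<Longrightarrow> f * S i = S i"
  shows "real d * rtr e \<le> rtr f"
proof -
  have "f * range_proj = range_proj"
    unfolding range_proj_def using assms(2) by (simp add: sum_distrib_left mult.assoc[symmetric])
  then show ?thesis using rtr_proj_mono[OF assms(1) proj_range_proj] by (simp add: rtr_range_proj)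
qed

lemma commute_range_proj:
  assumes "\<And>i. i < d \<Longrightarrow> range_proj * (g * S i) = g * S i"
    and "\<And>i. i < d \<Longrightarrow> range_proj * (adj g * S i) = adj g * S i"
  shows "g * range_proj = range_proj * g"
proof -
  have 1: "range_proj * (h * range_proj) = h * range_proj"
    if "\<And>i. i < d \<Longrightarrow> range_proj * (h * S i) = h * S i" for h
  proof -
    have "h * range_proj = (\<Sum>i<d. (h * S i) * adj (S i))"
      by (simp add: range_proj_def sum_distrib_left mult.assoc)
    moreover have "range_proj * (h * range_proj) = (\<Sum>i<d. range_proj * (h * S i) * adj (S i))"
      by (subst (2) range_proj_def) (simp add: sum_distrib_left mult.assoc)
    ultimately show ?thesis using that by simp
  qed
  have "adj (range_proj * (adj g * range_proj)) = adj (adj g * range_proj)"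
    using 1[OF assms(2)] by simp
  then show ?thesis using 1[OF assms(1)] projD(1)[OF proj_range_proj] by (simp add: mult.assoc)
qed

end

text \<open>Transporting one isometric system to another.\<close>

text \<open>
  Sending the copy of \<open>e\<close> embedded by \<open>S i\<close> to the one embedded by \<open>S' i\<close> gives a partial isometry \<open>T\<close>. It
  commutes with \<open>g\<close> if \<open>g\<close> has the same matrix coefficients in both systems and these coefficients
  determine both products: invariance of the range of \<open>S'\<close> under \<open>g\<close> expands \<open>g * T\<close>, and invariance
  of the range of \<open>S\<close> under \<open>adj g\<close> expands \<open>T * g\<close>.
\<close>

lemma isometric_intertwiner:
  assumes S: "isometric_system e d S" and S': "isometric_system e d S'"
  defines "F \<equiv> isometric_system.range_proj d S" and "F' \<equiv> isometric_system.range_proj d S'"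
  defines "T \<equiv> (\<Sum>i<d. S' i * adj (S i))"
  shows "adj T * T = F" and "T * adj T = F'"
    and "\<lbrakk>\<And>i. i < d \<Longrightarrow> F' * (g * S' i) = g * S' i; \<And>i. i < d \<Longrightarrow> F * (adj g * S i) = adj g * S i;
          \<And>i j. i < d \<Longrightarrow> j < d \<Longrightarrow> \<exists>c. adj (S i) * (g * S j) = c *\<^sub>C e \<and> adj (S' i) * (g * S' j) = c *\<^sub>C e\<rbrakk>
        \<Longrightarrow> g * T = T * g"
proof -
  interpret S: isometric_system e d S by (rule S)
  interpret S': isometric_system e d S' by (rule S')
  have TS: "T * S i = S' i" if "i < d" for i
    using that by (simp add: T_def sum_distrib_right mult.assoc S.S_orth S'.S_e if_distrib cong: if_cong)
  have adjT: "adj T = (\<Sum>i<d. S i * adj (S' i))" by (simp add: T_def adj_sum)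
  have TS': "adj T * S' i = S i" if "i < d" for i
    using that by (simp add: adjT sum_distrib_right mult.assoc S'.S_orth S.S_e if_distrib cong: if_cong)
  have "adj T * T = (\<Sum>i<d. adj T * S' i * adj (S i))"
    by (simp add: T_def[symmetric] mult.assoc sum_distrib_left[symmetric])
  then show "adj T * T = F" using TS' by (simp add: F_def S.range_proj_def)
  have "T * adj T = (\<Sum>i<d. T * S i * adj (S' i))"
    by (simp add: adjT mult.assoc sum_distrib_left[symmetric])
  then show "T * adj T = F'" using TS by (simp add: F'_def S'.range_proj_def)
  \<comment> \<open>Both products expand to the double sum of \<open>S' i * coefficient (i, j) * adj (S j)\<close>.\<close>
  assume F': "\<And>i. i < d \<Longrightarrow> F' * (g * S' i) = g * S' i" and F: "\<And>i. i < d \<Longrightarrow> F * (adj g * S i) = adj g * S i"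
    and coeff: "\<And>i j. i < d \<Longrightarrow> j < d \<Longrightarrow> \<exists>c. adj (S i) * (g * S j) = c *\<^sub>C e \<and> adj (S' i) * (g * S' j) = c *\<^sub>C e"
  have c': "S' i * (adj (S' i) * (g * S' j)) * adj (S j) = S' i * (adj (S i) * (g * S j)) * adj (S j)"
    if "i < d" "j < d" for i j
    using coeff[OF that] by auto
  have "g * T = (\<Sum>j<d. F' * (g * S' j) * adj (S j))"
    using F' by (simp add: T_def sum_distrib_left mult.assoc)
  also have "\<dots> = (\<Sum>j<d. \<Sum>i<d. S' i * (adj (S' i) * (g * S' j)) * adj (S j))"
    by (simp add: F'_def S'.range_proj_def sum_distrib_right sum_distrib_left mult.assoc)
  also have "\<dots> = (\<Sum>j<d. \<Sum>i<d. S' i * (adj (S i) * (g * S j)) * adj (S j))"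
    using c' by simp
  also have "\<dots> = (\<Sum>i<d. \<Sum>j<d. S' i * (adj (S i) * (g * S j)) * adj (S j))"
    by (rule sum.swap)
  also have "\<dots> = (\<Sum>i<d. S' i * (adj (S i) * g * F))"
    by (simp add: F_def S.range_proj_def sum_distrib_left mult.assoc)
  also have "\<dots> = (\<Sum>i<d. S' i * (adj (S i) * g))"
  proof (intro sum.cong refl)
    fix i assume "i \<in> {..<d}"
    then have "adj (F * (adj g * S i)) = adj (adj g * S i)" using F by simp
    then have "adj (S i) * g * F = adj (S i) * g"
      using projD(1)[OF S.proj_range_proj] by (simp add: F_def)
    then show "S' i * (adj (S i) * g * F) = S' i * (adj (S i) * g)" by simp
  qed
  also have "\<dots> = T * g" by (simp add: T_def sum_distrib_right mult.assoc)
  finally show "g * T = T * g" .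
qed

section \<open>Closed systems of short words\<close>

text \<open>
  A closed system exhibits a left ideal: the \<open>a i * e\<close> span a space that is invariant under \<open>D\<close> and its
  adjoint. The bound \<open>a i \<in> V i\<close> records that the ideal is reached by short words, and the last condition
  that all matrix coefficients of the generators are scalars.
\<close>

context unital_generator
begin

definition closed_system :: "fmat \<Rightarrow> nat \<Rightarrow> (nat \<Rightarrow> fmat) \<Rightarrow> bool" where
  "closed_system e d a \<longleftrightarrow> isometric_system e d (\<lambda>i. a i * e) \<and> (\<forall>i<d. a i \<in> V i) \<and>
     (\<forall>x. \<forall>i<d. isometric_system.range_proj d (\<lambda>i. a i * e) * (gen D x * (a i * e))
        = gen D x * (a i * e)) \<and>
     (\<forall>y\<in>V (2 * d). \<exists>c. e * y * e = c *\<^sub>C e)"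

text \<open>
  One step of the Gram-Schmidt process. If some \<open>gen D x * (a i * e)\<close> leaves the range of the system, its
  orthogonal component has the form \<open>y * e\<close> with \<open>y \<in> V d\<close>, because the coefficients to be subtracted
  are scalars. Its square \<open>e * adj y * y * e\<close> is again a scalar multiple of \<open>e\<close>, as \<open>adj y * y\<close> is in
  \<open>V (2 * d)\<close>, and rescaling \<open>y\<close> gives the new member.
\<close>

lemma extend_isometric_system:
  assumes e: "e \<noteq> 0"
    and S: "isometric_system e d (\<lambda>i. a i * e)" and a: "\<And>i. i < d \<Longrightarrow> a i \<in> V i"
    and scalar: "\<And>y. y \<in> V (2 * d) \<Longrightarrow> \<exists>c. e * y * e = c *\<^sub>C e"
    and i: "i < d"
    and ne: "isometric_system.range_proj d (\<lambda>i. a i * e) * (gen D x * (a i * e)) \<noteq> gen D x * (a i * e)"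
  shows "\<exists>z\<in>V d. isometric_system e (Suc d) (\<lambda>i. (a(d := z)) i * e)"
proof -
  interpret S: isometric_system e d "\<lambda>i. a i * e" by (rule S)
  have ee: "e * e = e" "adj e = e" using projD[OF S.proj_e] by auto
  define r where "r = gen D x * (a i * e)"
  have "\<exists>c. e * (adj (a j) * gen D x * a i) * e = c *\<^sub>C e" if "j < d" for j
  proof -
    have "adj (a j) * gen D x * a i \<in> V (j + 1 + i)"
      by (intro V_mult V_adj V_gen a that i)
    then show ?thesis using that i by (intro scalar) (erule V_mono, simp)
  qed
  then obtain c where c: "\<And>j. j < d \<Longrightarrow> e * (adj (a j) * gen D x * a i) * e = c j *\<^sub>C e" by metis
  define y where "y = gen D x * a i - (\<Sum>j<d. c j *\<^sub>C a j)"
  have yV: "y \<in> V d"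
  proof -
    have "gen D x * a i \<in> V d"
      using V_mult[OF V_gen a[OF i], of x] i by (elim V_mono) simp
    moreover have "(\<Sum>j<d. c j *\<^sub>C a j) \<in> V d"
      by (intro V_sum V_smul) (auto intro: V_mono[OF a])
    ultimately show ?thesis unfolding y_def by (rule V_diff)
  qed
  have Fr: "S.range_proj * r = (\<Sum>j<d. c j *\<^sub>C (a j * e))"
  proof -
    have "S.range_proj * r = (\<Sum>j<d. a j * (e * (adj (a j) * gen D x * a i) * e))"
      by (simp add: S.range_proj_def r_def sum_distrib_right mult.assoc ee mult.assoc[of e e, symmetric])
    then show ?thesis using c by simp
  qed
  have ye: "y * e = r - S.range_proj * r"
    unfolding Fr by (simp add: y_def r_def left_diff_distrib sum_distrib_right mult.assoc)
  have ye0: "y * e \<noteq> 0" using ne unfolding ye r_def by auto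
  have orth: "adj (a j * e) * (y * e) = 0" if "j < d" for j
    unfolding ye right_diff_distrib
    by (simp only: mult.assoc[symmetric] S.S_range_proj[OF that] diff_self)
  obtain g where g: "e * (adj y * y) * e = g *\<^sub>C e"
    using scalar[of "adj y * y"] V_mult[OF V_adj[OF yV] yV] by (auto simp: mult_2)
  then have ge: "adj (y * e) * (y * e) = g *\<^sub>C e" by (simp add: ee mult.assoc)
  have re: "rtr e > 0" using rtr_proj_ge_1[OF S.proj_e e] by simp
  define t where "t = rtr (adj (y * e) * (y * e)) / rtr e"
  obtain N where N: "supp_below N (y * e)" using supp_below_exists by blast
  have trt: "tr (adj (y * e) * (y * e)) = of_real (rtr (adj (y * e) * (y * e)))"
    using tr_adj_mult_self[OF N] by (simp add: rtr_def)
  then have "g * of_real (rtr e) = of_real (rtr (adj (y * e) * (y * e)))"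
    using tr_proj[OF S.proj_e] by (metis ge tr_smul)
  then have gt: "g = of_real t" using re by (simp add: t_def field_simps)
  have "tr (adj (y * e) * (y * e)) \<noteq> 0" using tr_adj_mult_eq_0[of "y * e"] ye0 by blast
  then have "rtr (adj (y * e) * (y * e)) \<noteq> 0" using trt by auto
  then have t: "t > 0"
    unfolding t_def using re rtr_adj_mult_nonneg[of "y * e"] by (simp add: less_le)
  define z where "z = (1 / of_real (sqrt t)) *\<^sub>C y"
  have zz: "adj (z * e) * (z * e) = e"
  proof -
    have "adj (z * e) * (z * e) = ((1 / of_real (sqrt t)) * (1 / of_real (sqrt t)) * g) *\<^sub>C e"
      using ge by (simp add: z_def mult.assoc)
    also have "\<dots> = e" using t unfolding gt by (simp add: of_real_mult[symmetric] del: of_real_mult)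
    finally show ?thesis .
  qed
  have zo: "adj (a j * e) * (z * e) = 0" if "j < d" for j
    using orth[OF that] by (simp add: z_def)
  have oz: "adj (z * e) * (a j * e) = 0" if "j < d" for j
  proof -
    have "adj (adj (a j * e) * (z * e)) = 0" by (simp only: zo[OF that] adj_zero)
    then show ?thesis by simp
  qed
  have "isometric_system e (Suc d) (\<lambda>i. (a(d := z)) i * e)"
  proof
    show "proj e" by (rule S.proj_e)
    show "(a(d := z)) j * e * e = (a(d := z)) j * e" for j by (simp add: mult.assoc ee)
    show "adj ((a(d := z)) j * e) * ((a(d := z)) l * e) = (if j = l then e else 0)"
      if jl: "j < Suc d" "l < Suc d" for j l
    proof -
      consider "j < d" "l < d" | "j = d" "l < d" | "j < d" "l = d" | "j = d" "l = d"
        using jl by (auto simp: less_Suc_eq)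
      then show ?thesis
      proof cases
        case 1 then show ?thesis using S.S_orth[of j l] by simp
      next
        case 2 then show ?thesis using oz[of l] by simp
      next
        case 3 then show ?thesis using zo[of j] by simp
      next
        case 4 then show ?thesis using zz by simp
      qed
    qed
  qed
  moreover have "z \<in> V d" unfolding z_def by (rule V_smul[OF yV])
  ultimately show ?thesis by blast
qed

text \<open>
  Take a system of maximal size \<open>d\<close>; the ranges of its members are orthogonal copies of \<open>e\<close> below \<open>I\<close>,
  which bounds \<open>d\<close>. If all coefficients in \<open>V (2 * d)\<close> are scalar, maximality forces closedness.
\<close>

lemma closed_system_or_nonscalar:
  assumes proj: "proj e" and e: "e \<noteq> 0" and eV: "e \<in> V k"
  shows "\<exists>d\<ge>1. real d * rtr e \<le> rtr I \<and>
           ((\<exists>a. closed_system e d a) \<or> (\<exists>y\<in>V (2 * d). \<forall>c. e * y * e \<noteq> c *\<^sub>C e))"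
proof -
  define P where "P d \<longleftrightarrow> (\<exists>a. isometric_system e d (\<lambda>i. a i * e) \<and> (\<forall>i<d. a i \<in> V i))" for d
  have bound: "real d * rtr e \<le> rtr I" if "P d" for d
  proof -
    obtain a where S: "isometric_system e d (\<lambda>i. a i * e)" and a: "\<forall>i<d. a i \<in> V i"
      using \<open>P d\<close> P_def by blast
    have "I * (a i * e) = a i * e" if "i < d" for i
      using a I_V[of "a i" i] that by (simp add: mult.assoc[symmetric])
    then show ?thesis by (rule isometric_system.rtr_bound[OF S proj_I])
  qed
  have bnd: "d \<le> nat \<lfloor>rtr I\<rfloor>" if "P d" for d
  proof -
    have "real d * 1 \<le> real d * rtr e"
      using rtr_proj_ge_1[OF proj e] by (intro mult_left_mono) auto
    then show ?thesis using bound[OF that] by (simp add: le_nat_floor)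
  qed
  have "isometric_system e 1 (\<lambda>i. I * e)"
    by standard (use proj I_V[OF eV] projD[OF proj] in auto)
  then have P1: "P 1" unfolding P_def using V_I by (intro exI[of _ "\<lambda>_. I"]) simp
  \<comment> \<open>Systems of one element exist, and the trace bounds their size.\<close>
  define d where "d = (GREATEST d. P d)"
  have Pd: "P d" unfolding d_def using P1 bnd by (intro GreatestI_nat[of P 1]) auto
  have max: "j \<le> d" if "P j" for j
    unfolding d_def using that bnd by (intro Greatest_le_nat[of P]) auto
  have d1: "1 \<le> d" using max[OF P1] .
  obtain a where S: "isometric_system e d (\<lambda>i. a i * e)" and a: "\<And>i. i < d \<Longrightarrow> a i \<in> V i"
    using Pd P_def by blast
  have "(\<exists>a. closed_system e d a) \<or> (\<exists>y\<in>V (2 * d). \<forall>c. e * y * e \<noteq> c *\<^sub>C e)"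
  proof (rule disjCI)
    assume "\<not> (\<exists>y\<in>V (2 * d). \<forall>c. e * y * e \<noteq> c *\<^sub>C e)"
    then have scalar: "\<And>y. y \<in> V (2 * d) \<Longrightarrow> \<exists>c. e * y * e = c *\<^sub>C e" by blast
    have "isometric_system.range_proj d (\<lambda>i. a i * e) * (gen D x * (a i * e)) = gen D x * (a i * e)"
      if i: "i < d" for x i
    proof (rule ccontr)
      assume "\<not> ?thesis"
      from extend_isometric_system[OF e S a scalar i this]
      obtain z where "z \<in> V d" "isometric_system e (Suc d) (\<lambda>i. (a(d := z)) i * e)" by blast
      then have "P (Suc d)" unfolding P_def using a
        by (intro exI[of _ "a(d := z)"]) (auto simp: less_Suc_eq)
      then show False using max by fastforce
    qed
    then show "\<exists>a. closed_system e d a"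
      unfolding closed_system_def using S a scalar by blast
  qed
  then show ?thesis using d1 bound[OF Pd] by blast
qed

text \<open>
  The real or the imaginary part of \<open>y\<close> is nonscalar in the corner of \<open>e\<close> as well, and its spectral
  projection of smallest trace has the required properties. A product of \<open>m - 1\<close> factors \<open>e * h * e\<close> needs
  \<open>e\<close> only \<open>m\<close> times, whence the length \<open>m * k + (m - 1) * t\<close>.
\<close>

lemma shrink_projection:
  assumes proj: "proj e" and e: "e \<noteq> 0" and eV: "e \<in> V k"
    and y: "y \<in> V t" "\<And>c. e * y * e \<noteq> c *\<^sub>C e"
  obtains f m where "2 \<le> m" "proj f" "f \<noteq> 0" "f \<in> V (m * k + (m - 1) * t)"
    "real m * rtr f \<le> rtr e"
proof -
  have "\<exists>h\<in>V t. adj h = h \<and> (\<forall>c. e * h * e \<noteq> c *\<^sub>C e)"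
  proof (rule ccontr)
    assume "\<not> ?thesis"
    then have *: "\<And>h. h \<in> V t \<Longrightarrow> adj h = h \<Longrightarrow> \<exists>c. e * h * e = c *\<^sub>C e" by blast
    obtain c1 where c1: "e * (y + adj y) * e = c1 *\<^sub>C e"
      using *[of "y + adj y"] V_add[OF y(1) V_adj[OF y(1)]] by (auto simp: add.commute)
    have "adj (\<i> *\<^sub>C (y - adj y)) = \<i> *\<^sub>C (y - adj y)"
      by (simp add: fmat.scale_right_diff_distrib)
    then obtain c2 where c2: "e * (\<i> *\<^sub>C (y - adj y)) * e = c2 *\<^sub>C e"
      using *[of "\<i> *\<^sub>C (y - adj y)"] V_smul[OF V_diff[OF y(1) V_adj[OF y(1)]], of \<i>] by auto
    have "y = (1/2) *\<^sub>C ((y + adj y) + (-\<i>) *\<^sub>C (\<i> *\<^sub>C (y - adj y)))"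
      by (rule fmat_eqI) (simp add: algebra_simps flip: mult.assoc)
    then have "e * y * e = (1/2) *\<^sub>C (e * (y + adj y) * e + (-\<i>) *\<^sub>C (e * (\<i> *\<^sub>C (y - adj y)) * e))"
      by (metis (no_types) distrib_left distrib_right smul_mult_left smul_mult_right)
    also have "\<dots> = ((1/2) * (c1 + (-\<i>) * c2)) *\<^sub>C e"
      unfolding c1 c2 fmat.scale_scale fmat.scale_left_distrib[symmetric] ..
    finally show False using y(2) by blast
  qed
  then obtain h where h: "h \<in> V t" "adj h = h" "\<And>c. e * h * e \<noteq> c *\<^sub>C e" by blast
  interpret C: corner_element e "e * h * e"
    by standard (use proj in \<open>auto simp: projD mult.assoc\<close>)
  have sa: "adj (e * h * e) = e * h * e" using projD[OF proj] h(2) by (simp add: mult.assoc)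
  obtain p where p: "1 \<le> degree p" "proj (peval e (e * h * e) p)" "peval e (e * h * e) p \<noteq> 0"
    "real (degree p + 1) * rtr (peval e (e * h * e) p) \<le> rtr e"
    using C.small_spectral_projection[OF sa h(3)] by blast
  have "degree q \<le> n \<Longrightarrow> peval e (e * h * e) q \<in> V ((n + 1) * k + n * t)" for q n
  proof (induction q arbitrary: n)
    case 0
    then show ?case using fmat.subspace_0[OF subspace_V] by simp
  next
    case (pCons c q)
    show ?case
    proof (cases "q = 0")
      case True
      then show ?thesis using V_smul[OF eV, of c] by (auto elim: V_mono)
    next
      case False
      then obtain n' where n': "n = Suc n'" "degree q \<le> n'"
        using pCons.prems by (cases n) auto
      have "e * h * peval e (e * h * e) q \<in> V (k + t + ((n' + 1) * k + n' * t))"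
        by (intro V_mult eV h(1) pCons.IH n')
      moreover have "e * h * e * peval e (e * h * e) q = e * h * peval e (e * h * e) q"
        using C.e_peval[of q] by (simp only: mult.assoc)
      ultimately have "e * h * e * peval e (e * h * e) q \<in> V ((n + 1) * k + n * t)"
        by (simp add: n' algebra_simps)
      moreover have "c *\<^sub>C e \<in> V ((n + 1) * k + n * t)"
        using V_smul[OF eV, of c] by (elim V_mono) simp
      ultimately show ?thesis by (simp add: V_add)
    qed
  qed
  from this[of p "degree p"] p show ?thesis
    by (intro that[of "degree p + 1" "peval e (e * h * e) p"]) auto
qed

end

text \<open>
  The cost of one shrinking step by the factor \<open>m\<close>, relative to the trace of the unit, against the gain
  \<open>log 2 m\<close>. Equality holds for \<open>m = 2\<close>.
\<close>

lemma log2_ge_of_nat: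
  assumes "2 \<le> (m :: nat)"
  shows "2 * (1 - 1 / real m) \<le> log 2 (real m)"
proof -
  consider "m = 2" | "m = 3" | "4 \<le> m" using assms by linarith
  then show ?thesis
  proof cases
    case 1 then show ?thesis by simp
  next
    case 2
    have "4 = log 2 (2 ^ 4)" using log_pow_cancel[of 2 4] by simp
    also have "\<dots> \<le> log 2 (3 ^ 3)" by (subst log_le_cancel_iff) auto
    also have "\<dots> = 3 * log 2 3" using log_nat_power[of 3 2 3] by simp
    finally show ?thesis using 2 by simp
  next
    case 3
    have "2 = log 2 (2 ^ 2)" using log_pow_cancel[of 2 2] by simp
    also have "\<dots> \<le> log 2 (real m)" using 3 by (subst log_le_cancel_iff) auto
    finally have "2 \<le> log 2 (real m)" .
    moreover have "2 * (1 - 1 / real m) \<le> 2" using 3 by simp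
    ultimately show ?thesis by linarith
  qed
qed

context unital_generator
begin

text \<open>
  The product of the word length \<open>k\<close> and the trace of the projection serves as potential. Shrinking by
  the factor \<open>m\<close> multiplies \<open>k\<close> by \<open>m\<close> and divides the trace by \<open>m\<close>, so the product grows only by
  \<open>(1 - 1 / m) * 2 * d * rtr e\<close>; since \<open>d * rtr e \<le> rtr I\<close> this is at most \<open>rtr I * log 2 m\<close>. As long
  as no closed system appears, the trace is at least halved in each round.
\<close>

lemma cheap_small_projection:
  assumes I0: "I \<noteq> 0"
    and no: "\<And>e k d a. proj e \<Longrightarrow> e \<noteq> 0 \<Longrightarrow> e \<in> V k \<Longrightarrow> 1 \<le> d
      \<Longrightarrow> real k * rtr e \<le> rtr I * log 2 (rtr I / rtr e) \<Longrightarrow> real d * rtr e \<le> rtr I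
      \<Longrightarrow> \<not> closed_system e d a"
  shows "\<exists>e k. proj e \<and> e \<noteq> 0 \<and> e \<in> V k \<and>
    real k * rtr e \<le> rtr I * log 2 (rtr I / rtr e) \<and> 2 ^ j * rtr e \<le> rtr I"
proof (induction j)
  case 0
  have "rtr I > 0" using rtr_proj_ge_1[OF proj_I I0] by simp
  then show ?case using proj_I I0 V_I[of 0] by (intro exI[of _ I] exI[of _ 0]) simp
next
  case (Suc j)
  then obtain e k where e: "proj e" "e \<noteq> 0" "e \<in> V k"
    and k: "real k * rtr e \<le> rtr I * log 2 (rtr I / rtr e)" and j: "2 ^ j * rtr e \<le> rtr I" by blast
  obtain d where d: "1 \<le> d" "real d * rtr e \<le> rtr I"
    and alt: "(\<exists>a. closed_system e d a) \<or> (\<exists>y\<in>V (2 * d). \<forall>c. e * y * e \<noteq> c *\<^sub>C e)"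
    using closed_system_or_nonscalar[OF e] by blast
  obtain y where y: "y \<in> V (2 * d)" "\<And>c. e * y * e \<noteq> c *\<^sub>C e"
    using alt no[OF e d(1) k d(2)] by blast
  obtain f m where m: "2 \<le> m" and f: "proj f" "f \<noteq> 0" "f \<in> V (m * k + (m - 1) * (2 * d))"
    and fe: "real m * rtr f \<le> rtr e"
    using shrink_projection[OF e y] by blast
  have rI: "rtr I > 0" using rtr_proj_ge_1[OF proj_I I0] by simp
  have rf: "rtr f > 0" using rtr_proj_ge_1[OF f(1,2)] by simp
  have re: "rtr e > 0" using rtr_proj_ge_1[OF e(1,2)] by simp
  define r where "r = rtr e / real m"
  have fr: "rtr f \<le> r" using fe m by (simp add: r_def field_simps)
  have r0: "r > 0" using re m by (simp add: r_def)
  have "real (m * k + (m - 1) * (2 * d)) * rtr f \<le> real (m * k + (m - 1) * (2 * d)) * r"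
    using fr by (intro mult_left_mono) auto
  also have "\<dots> = real k * rtr e + 2 * (1 - 1 / real m) * (real d * rtr e)"
    using m by (simp add: r_def field_simps of_nat_diff)
  also have "\<dots> \<le> rtr I * log 2 (rtr I / rtr e) + 2 * (1 - 1 / real m) * rtr I"
    using k d(2) m by (intro add_mono mult_left_mono) (auto simp: divide_le_eq)
  also have "\<dots> \<le> rtr I * log 2 (rtr I / rtr e) + log 2 (real m) * rtr I"
    using log2_ge_of_nat[OF m] rI by (intro add_left_mono mult_right_mono) auto
  also have "\<dots> = rtr I * log 2 (rtr I / r)"
  proof -
    have "rtr I / r = rtr I / rtr e * real m" by (simp add: r_def)
    moreover have "log 2 (rtr I / rtr e * real m) = log 2 (rtr I / rtr e) + log 2 (real m)"
      using rI re m by (subst log_mult) auto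
    ultimately have "log 2 (rtr I / r) = log 2 (rtr I / rtr e) + log 2 (real m)" by (simp only:)
    then show ?thesis by (simp only: distrib_left mult.commute[of "log 2 (real m)"])
  qed
  also have "\<dots> \<le> rtr I * log 2 (rtr I / rtr f)"
    using rI rf r0 fr by (intro mult_left_mono log_mono divide_left_mono) auto
  finally have kf: "real (m * k + (m - 1) * (2 * d)) * rtr f \<le> rtr I * log 2 (rtr I / rtr f)" .
  have "2 * rtr f \<le> real m * rtr f" using m rf by (intro mult_right_mono) auto
  then have "2 ^ Suc j * rtr f \<le> 2 ^ j * rtr e" using fe by (simp add: mult.assoc mult.left_commute)
  then have "2 ^ Suc j * rtr f \<le> rtr I" using j by linarith
  then show ?case using f kf by blast
qed

text \<open>
  Traces of nonzero projections are at least 1, so they cannot be halved forever.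
\<close>

lemma closed_system_exists:
  assumes I0: "I \<noteq> 0"
  obtains e k d a where "proj e" "e \<noteq> 0" "e \<in> V k" "1 \<le> d" "closed_system e d a"
    "real (k + 2 * (d - 1)) \<le> rtr I * log 2 (rtr I) + 2 * rtr I - 2"
proof -
  have I1: "rtr I \<ge> 1" using rtr_proj_ge_1[OF proj_I I0] .
  have "\<exists>e k d a. proj e \<and> e \<noteq> 0 \<and> e \<in> V k \<and> 1 \<le> d \<and> closed_system e d a \<and>
      real k * rtr e \<le> rtr I * log 2 (rtr I / rtr e) \<and> real d * rtr e \<le> rtr I"
  proof (rule ccontr)
    assume "\<not> ?thesis"
    then have no: "\<And>e k d a. proj e \<Longrightarrow> e \<noteq> 0 \<Longrightarrow> e \<in> V k \<Longrightarrow> 1 \<le> d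
      \<Longrightarrow> real k * rtr e \<le> rtr I * log 2 (rtr I / rtr e) \<Longrightarrow> real d * rtr e \<le> rtr I
      \<Longrightarrow> \<not> closed_system e d a" by blast
    obtain j where j: "rtr I < 2 ^ j" using real_arch_pow[of 2 "rtr I"] by auto
    have "\<exists>e k. proj e \<and> e \<noteq> 0 \<and> e \<in> V k \<and>
        real k * rtr e \<le> rtr I * log 2 (rtr I / rtr e) \<and> 2 ^ j * rtr e \<le> rtr I"
      by (rule cheap_small_projection[OF I0]) (rule no)
    then obtain e where "proj e" "e \<noteq> 0" and le: "2 ^ j * rtr e \<le> rtr I" by blast
    then have "1 \<le> rtr e" by (intro rtr_proj_ge_1)
    then have "2 ^ j * 1 \<le> 2 ^ j * rtr e" by (intro mult_left_mono) auto
    then show False using le j by linarith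
  qed
  then obtain e k d a where e: "proj e" "e \<noteq> 0" "e \<in> V k" "1 \<le> d" "closed_system e d a"
    and k: "real k * rtr e \<le> rtr I * log 2 (rtr I / rtr e)" and d: "real d * rtr e \<le> rtr I" by blast
  have e1: "rtr e \<ge> 1" using rtr_proj_ge_1[OF e(1,2)] .
  have "1 * rtr e \<le> real d * rtr e" using e(4) e1 by (intro mult_right_mono) auto
  then have eI: "rtr e \<le> rtr I" using d by linarith
  have "real k * 1 \<le> real k * rtr e" using e1 by (intro mult_left_mono) auto
  also have "\<dots> \<le> rtr I * log 2 (rtr I / rtr e)" by (rule k)
  also have "\<dots> \<le> rtr I * log 2 (rtr I)"
    using e1 I1 eI by (intro mult_left_mono log_mono) (auto simp: field_simps)
  finally have k': "real k \<le> rtr I * log 2 (rtr I)" by simp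
  have "real d * 1 \<le> real d * rtr e" using e1 by (intro mult_left_mono) auto
  then have "real d \<le> rtr I" using d by linarith
  then have "real (k + 2 * (d - 1)) \<le> rtr I * log 2 (rtr I) + 2 * rtr I - 2"
    using k' e(4) by (simp add: of_nat_diff)
  with e show ?thesis by (rule that)
qed

end

section \<open>Cutting down by a commuting projection\<close>

context unital_generator
begin

lemma gen_commute:
  assumes "proj G" "D * G = G * D"
  shows "gen D x * G = G * gen D x"
  using assms by (cases x; metis adj_mult gen.simps projD(1))

lemma V_commute:
  assumes "proj G" "D * G = G * D" "I * G = G" "x \<in> V k"
  shows "x * G = G * x"
proof -
  have GI: "G * I = G" using proj_absorb_swap[OF proj_I assms(1,3)] .
  have w: "weval I D w * G = G * weval I D w" for w
  proof (induction w)
    case (Cons y w)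
    have "gen D y * weval I D w * G = gen D y * G * weval I D w"
      using Cons.IH by (simp add: mult.assoc)
    then show ?case using gen_commute[OF assms(1,2), of y] by (simp add: mult.assoc)
  qed (simp add: assms(3) GI)
  have "x \<in> {x. x * G = G * x}"
    by (intro V_induct[OF assms(4)]) (auto simp: fmat.subspace_def distrib_left distrib_right w)
  then show ?thesis by simp
qed

text \<open>
  A projection commuting with \<open>D\<close> restricts the generated algebra to an invariant subspace. The
  restricted algebra is again given by a unit and a generator, and restriction maps words to words,
  so all results about \<open>V\<close> apply to it.
\<close>

lemma cut_unital:
  assumes "proj G" "D * G = G * D"
  shows "unital_generator G (D * G)"
  using assms by unfold_locales (auto simp: mult.assoc projD)

lemma cut_gen: "proj G \<Longrightarrow> D * G = G * D \<Longrightarrow> gen (D * G) x = gen D x * G"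
  using gen_commute[of G x] by (cases x) (auto simp: projD)

lemma cut_weval:
  assumes "proj G" "D * G = G * D" "I * G = G"
  shows "weval G (D * G) w = weval I D w * G"
proof (induction w)
  case (Cons y w)
  have "gen (D * G) y * weval G (D * G) w = gen D y * (G * weval I D w) * G"
    using Cons.IH by (simp add: cut_gen[OF assms(1,2)] mult.assoc)
  also have "\<dots> = gen D y * (weval I D w * G) * G"
    by (simp only: V_commute[OF assms V_weval[OF order_refl]])
  finally show ?case by (simp add: mult.assoc projD[OF assms(1)])
qed (simp add: assms(3))

lemma cut_V_mem:
  assumes "proj G" "D * G = G * D" "I * G = G" "y \<in> words_span G (D * G) k"
  obtains x where "x \<in> V k" "y = x * G"
proof -
  interpret C: unital_generator G "D * G" by (rule cut_unital[OF assms(1,2)])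
  have sub: "fmat.subspace ((\<lambda>x. x * G) ` V k)"
    unfolding fmat.subspace_def
  proof (intro conjI ballI allI)
    show "0 \<in> (\<lambda>x. x * G) ` V k"
      using fmat.subspace_0[OF subspace_V] by (intro image_eqI[of _ _ 0]) auto
  next
    fix a b assume "a \<in> (\<lambda>x. x * G) ` V k" "b \<in> (\<lambda>x. x * G) ` V k"
    then obtain x z where "x \<in> V k" "z \<in> V k" "a = x * G" "b = z * G" by blast
    then show "a + b \<in> (\<lambda>x. x * G) ` V k"
      by (intro image_eqI[of _ _ "x + z"]) (auto simp: distrib_right V_add)
  next
    fix c a assume "a \<in> (\<lambda>x. x * G) ` V k"
    then obtain x where "x \<in> V k" "a = x * G" by blast
    then show "c *\<^sub>C a \<in> (\<lambda>x. x * G) ` V k"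
      by (intro image_eqI[of _ _ "c *\<^sub>C x"]) (auto simp: V_smul)
  qed
  have "y \<in> (\<lambda>x. x * G) ` V k"
    by (rule C.V_induct[OF assms(4) sub]) (auto simp: cut_weval[OF assms(1-3)] intro: V_weval)
  then show ?thesis using that by blast
qed

lemma mem_cut_V:
  assumes "proj G" "D * G = G * D" "I * G = G" "x \<in> V k"
  shows "x * G \<in> words_span G (D * G) k"
proof -
  interpret C: unital_generator G "D * G" by (rule cut_unital[OF assms(1,2)])
  have "x \<in> {x. x * G \<in> words_span G (D * G) k}"
    by (intro V_induct[OF assms(4)] subspace_vimage_mult_left C.subspace_V)
      (auto simp: cut_weval[OF assms(1-3), symmetric] intro: C.V_weval)
  then show ?thesis by simp
qed

lemma closed_system_coeffs:
  assumes cs: "closed_system e d a" and i: "i < d"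
  shows "\<exists>c. gen D x * (a i * e) = (\<Sum>j<d. c j *\<^sub>C (a j * e))"
proof -
  interpret S: isometric_system e d "\<lambda>i. a i * e" using cs by (simp add: closed_system_def)
  have ee: "e * e = e" "adj e = e" using projD[OF S.proj_e] by auto
  have a: "\<And>i. i < d \<Longrightarrow> a i \<in> V i" using cs by (simp add: closed_system_def)
  have "\<exists>c. e * (adj (a j) * gen D x * a i) * e = c *\<^sub>C e" if "j < d" for j
  proof -
    have "adj (a j) * gen D x * a i \<in> V (j + 1 + i)"
      by (intro V_mult V_adj V_gen a that i)
    then have "adj (a j) * gen D x * a i \<in> V (2 * d)" by (rule V_mono) (use that i in simp)
    then show ?thesis using cs by (simp add: closed_system_def)
  qed
  then obtain c where c: "\<And>j. j < d \<Longrightarrow> e * (adj (a j) * gen D x * a i) * e = c j *\<^sub>C e" by metis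
  have "gen D x * (a i * e) = S.range_proj * (gen D x * (a i * e))"
    using cs i by (simp add: closed_system_def)
  also have "\<dots> = (\<Sum>j<d. a j * (e * (adj (a j) * gen D x * a i) * e))"
    by (simp add: S.range_proj_def sum_distrib_right mult.assoc ee mult.assoc[of e e, symmetric])
  finally show ?thesis using c by auto
qed

lemma closed_system_range_commute:
  assumes cs: "closed_system e d a"
  defines "F \<equiv> isometric_system.range_proj d (\<lambda>i. a i * e)"
  shows "D * F = F * D" and "I * F = F" and "proj F"
proof -
  interpret S: isometric_system e d "\<lambda>i. a i * e" using cs by (simp add: closed_system_def)
  have "F * (gen D x * (a i * e)) = gen D x * (a i * e)" if "i < d" for i x
    using cs that by (simp add: closed_system_def F_def)
  from this[of _ Lx] this[of _ Ly] show "D * F = F * D"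
    unfolding F_def by (intro S.commute_range_proj) auto
  have "I * a i = a i" if "i < d" for i
    using cs that by (auto simp: closed_system_def intro: I_V)
  then show "I * F = F"
    by (simp add: F_def S.range_proj_def sum_distrib_left mult.assoc[symmetric])
  show "proj F" unfolding F_def by (rule S.proj_range_proj)
qed

text \<open>
  Multiplying by the range projection of a closed system turns arbitrarily long words into short
  ones: a word maps each \<open>a i * e\<close> into the span of the \<open>a j * e\<close>, so its product with the range
  projection is a combination of the elements \<open>a j * e * adj (a i)\<close>.
\<close>

lemma closed_system_ideal:
  assumes cs: "closed_system e d a" and e: "e \<in> V k" and x: "x \<in> V l"
  shows "x * isometric_system.range_proj d (\<lambda>i. a i * e) \<in> V (k + 2 * (d - 1))"
proof -
  interpret S: isometric_system e d "\<lambda>i. a i * e" using cs by (simp add: closed_system_def)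
  have ee: "e * (e * z) = e * z" "adj e = e" for z using projD[OF S.proj_e] by auto
  have a: "\<And>i. i < d \<Longrightarrow> a i \<in> V i" using cs by (simp add: closed_system_def)
  define W where "W = fmat.span ((\<lambda>i. a i * e) ` {..<d})"
  have gW: "gen D y * z \<in> W" if "z \<in> W" for y z
  proof -
    have "z \<in> {z. gen D y * z \<in> W}"
      using that unfolding W_def
    proof (rule subsetD[OF fmat.span_minimal, rotated 2])
      show "fmat.subspace {z. gen D y * z \<in> fmat.span ((\<lambda>i. a i * e) ` {..<d})}"
        by (intro subspace_vimage_mult_right fmat.subspace_span)
      show "(\<lambda>i. a i * e) ` {..<d} \<subseteq> {z. gen D y * z \<in> fmat.span ((\<lambda>i. a i * e) ` {..<d})}"
      proof clarify
        fix i assume "i < d"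
        then obtain c where "gen D y * (a i * e) = (\<Sum>j<d. c j *\<^sub>C (a j * e))"
          using closed_system_coeffs[OF cs] by blast
        then show "gen D y * (a i * e) \<in> fmat.span ((\<lambda>i. a i * e) ` {..<d})"
          by (auto intro!: fmat.span_sum fmat.span_scale intro: fmat.span_base)
      qed
    qed
    then show ?thesis by simp
  qed
  have wW: "weval I D w * (a i * e) \<in> W" if "i < d" for w i
  proof (induction w)
    case Nil
    have "I * (a i * e) = a i * e" using I_V[OF a[OF that]] by (simp add: mult.assoc[symmetric])
    then show ?case using that by (auto simp: W_def intro: fmat.span_base)
  next
    case (Cons y w)
    then show ?case using gW by (simp add: mult.assoc)
  qed
  have Wa: "z * adj (a i * e) \<in> V (k + 2 * (d - 1))" if "z \<in> W" "i < d" for z i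
  proof -
    have "a j * e * adj (a i * e) \<in> V (k + 2 * (d - 1))" if "j < d" for j
    proof -
      have "a j * e * adj (a i) \<in> V (j + k + i)"
        by (intro V_mult V_adj a e that \<open>i < d\<close>)
      then have "a j * e * adj (a i) \<in> V (k + 2 * (d - 1))"
        by (rule V_mono) (use that \<open>i < d\<close> in simp)
      then show ?thesis by (simp add: mult.assoc ee)
    qed
    then have "(\<lambda>i. a i * e) ` {..<d} \<subseteq> {z. z * adj (a i * e) \<in> V (k + 2 * (d - 1))}" by blast
    then have "W \<subseteq> {z. z * adj (a i * e) \<in> V (k + 2 * (d - 1))}"
      unfolding W_def by (intro fmat.span_minimal subspace_vimage_mult_left subspace_V)
    then show ?thesis using that by blast
  qed
  have "x \<in> {x. x * S.range_proj \<in> V (k + 2 * (d - 1))}"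
  proof (intro V_induct[OF x] subspace_vimage_mult_left subspace_V)
    fix w
    have "weval I D w * S.range_proj = (\<Sum>i<d. weval I D w * (a i * e) * adj (a i * e))"
      by (simp add: S.range_proj_def sum_distrib_left mult.assoc)
    also have "\<dots> \<in> V (k + 2 * (d - 1))"
      by (intro V_sum Wa wW) auto
    finally show "weval I D w \<in> {x. x * S.range_proj \<in> V (k + 2 * (d - 1))}" by simp
  qed
  then show ?thesis by simp
qed

end

section \<open>The length of the algebra\<close>

text \<open>
  A central projection \<open>F\<close> of trace at least 1 is split off and the induction hypothesis is used
  below \<open>I - F\<close>: a word \<open>x\<close> agrees there with some \<open>v\<close> in \<open>V l\<close>, and the error \<open>(x - v) * F\<close> lies in the
  ideal that consists of short words anyway. The bounds for the pieces are therefore combined by a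
  maximum, not by a sum.
\<close>

lemma words_span_stable:
  assumes "unital_generator I D" "rtr I \<le> real n" "1 \<le> n"
    and l: "real n * log 2 (real n) + 2 * real n - 2 \<le> real l"
  shows "weval I D w \<in> words_span I D l"
proof -
  have "unital_generator I D \<Longrightarrow> rtr I \<le> real n \<Longrightarrow> rtr I < real m \<Longrightarrow> weval I D w \<in> words_span I D l"
    for m I D
  proof (induction m arbitrary: I D)
    case 0
    then show ?case using rtr_proj_nonneg[of I] by (simp add: unital_generator_def)
  next
    case (Suc m)
    interpret unital_generator I D by (rule Suc.prems)
    show ?case
    proof (cases "I = 0")
      case True
      then have "weval I D w = 0" using I_weval[of w] by simp
      then show ?thesis using fmat.subspace_0[OF subspace_V] by simp
    next
      case False
      obtain e k d a where e: "proj e" "e \<noteq> 0" "e \<in> V k" "1 \<le> d" and cs: "closed_system e d a"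
        and kd: "real (k + 2 * (d - 1)) \<le> rtr I * log 2 (rtr I) + 2 * rtr I - 2"
        using closed_system_exists[OF False] by blast
      have I1: "1 \<le> rtr I" using rtr_proj_ge_1[OF proj_I False] .
      have "rtr I * log 2 (rtr I) \<le> real n * log 2 (real n)"
        using I1 Suc.prems(2) by (intro mult_mono) auto
      then have "real (k + 2 * (d - 1)) \<le> real l" using kd l Suc.prems(2) by linarith
      then have kdl: "k + 2 * (d - 1) \<le> l" by (simp only: of_nat_le_iff)
      interpret S: isometric_system e d "\<lambda>i. a i * e" using cs by (simp add: closed_system_def)
      note F = closed_system_range_commute[OF cs]
      define G where "G = I - S.range_proj"
      have FI: "S.range_proj * I = S.range_proj" using proj_absorb_swap[OF proj_I F(3,2)] .
      have G: "proj G" "D * G = G * D" "I * G = G"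
        unfolding G_def using proj_diff[OF proj_I F(3,2)] F(1,2) ID DI projD[OF proj_I]
        by (auto simp: right_diff_distrib left_diff_distrib)
      have "1 * 1 \<le> real d * rtr e" using e rtr_proj_ge_1[OF e(1,2)] by (intro mult_mono) auto
      then have rG: "rtr G \<le> rtr I - 1" by (simp add: G_def rtr_diff S.rtr_range_proj)
      have "weval G (D * G) w \<in> words_span G (D * G) l"
        using Suc.prems rG by (intro Suc.IH cut_unital G) auto
      then obtain v where v: "v \<in> V l" "weval I D w * G = v * G"
        using cut_V_mem[OF G] cut_weval[OF G] by metis
      have "weval I D w - v = (weval I D w - v) * I"
        using weval_I V_I_right[OF v(1)] by (simp add: left_diff_distrib)
      also have "\<dots> = (weval I D w - v) * G + (weval I D w - v) * S.range_proj"
        by (simp add: G_def right_diff_distrib)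
      finally have "weval I D w = v + (weval I D w * S.range_proj - v * S.range_proj)"
        using v(2) by (simp add: left_diff_distrib algebra_simps)
      moreover have "weval I D w * S.range_proj \<in> V l" "v * S.range_proj \<in> V l"
        using V_mono[OF closed_system_ideal[OF cs e(3) V_weval[OF order_refl]] kdl]
          V_mono[OF closed_system_ideal[OF cs e(3) v(1)] kdl] by auto
      ultimately show ?thesis using v(1) by (metis V_add V_diff)
    qed
  qed
  moreover obtain m where "rtr I < real m" using reals_Archimedean2 by blast
  ultimately show ?thesis using assms(1,2) by blast
qed

section \<open>Equivalence of commuting projections\<close>

lemma (in isometric_system) coeffs_range:
  assumes "g = (\<Sum>j<d. c j *\<^sub>C S j)"
  shows "range_proj * g = g" and "i < d \<Longrightarrow> adj (S i) * g = c i *\<^sub>C e"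
proof -
  show "range_proj * g = g" unfolding assms by (simp add: sum_distrib_left range_proj_S)
  show "adj (S i) * g = c i *\<^sub>C e" if "i < d"
    unfolding assms using that
    by (simp add: sum_distrib_left S_orth if_distrib[of "smul _"] cong: if_cong)
qed

lemma partial_isometry:
  assumes "proj (adj t * t)"
  shows "t * (adj t * t) = t"
proof -
  have "adj (t - t * (adj t * t)) * (t - t * (adj t * t)) = 0"
    using projD(2)[OF assms] by (simp add: right_diff_distrib left_diff_distrib mult.assoc)
  then show ?thesis by (simp only: adj_mult_eq_0 right_minus_eq)
qed

context unital_generator
begin

text \<open>
  The trace is faithful: \<open>y * G = z * G\<close> is the vanishing of \<open>tr (adj (y - z) * (y - z) * G)\<close>, a combination
  of traces of words of twice the length, and these traces are the same for \<open>H\<close>.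
\<close>

lemma relation_transfer:
  assumes G: "proj G" "D * G = G * D" "I * G = G"
    and H: "proj H" "D * H = H * D" "I * H = H"
    and tr: "\<And>w. length w \<le> k + k \<Longrightarrow> tr (weval I D w * G) = tr (weval I D w * H)"
    and y: "y \<in> V k" and z: "z \<in> V k" and eq: "y * G = z * G"
  shows "y * H = z * H"
proof -
  define x where "x = adj (y - z) * (y - z)"
  have yz: "y - z \<in> V k" by (rule V_diff[OF y z])
  have xV: "x \<in> V (k + k)" unfolding x_def by (intro V_mult V_adj yz)
  have "x \<in> {x. tr (x * G) = tr (x * H)}"
    by (intro V_induct[OF xV]) (auto simp: fmat.subspace_def distrib_right tr_add tr_smul tr)
  moreover have "x * G = 0" using eq by (simp add: x_def mult.assoc left_diff_distrib)
  ultimately have "tr (x * H) = 0" by simp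
  moreover have "tr (adj ((y - z) * H) * ((y - z) * H)) = tr (x * H)"
  proof -
    have "adj ((y - z) * H) * ((y - z) * H) = H * (x * H)"
      using projD(1)[OF H(1)] by (simp add: x_def mult.assoc)
    also have "tr \<dots> = tr (x * H)"
      by (subst tr_mult_commute) (simp add: mult.assoc projD[OF H(1)])
    finally show ?thesis .
  qed
  ultimately have "(y - z) * H = 0" using tr_adj_mult_eq_0 by metis
  then show ?thesis by (simp add: left_diff_distrib)
qed

text \<open>
  A closed system below \<open>G\<close> consists of elements \<open>e = v * G\<close> and \<open>a i = b i * G\<close> for combinations of words
  \<open>v\<close> and \<open>b i\<close>. That \<open>v * G\<close> is a projection, that the \<open>b i * v * G\<close> form an isometric system, and how
  the generators act on it are linear relations between words cut by \<open>G\<close>, so the same holds with \<open>H\<close> in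
  place of \<open>G\<close>. To obtain systems over the same projection, both are applied to single unit vectors \<open>c\<close>
  and \<open>c'\<close> in the ranges of \<open>v * G\<close> and \<open>v * H\<close>; then \<open>isometric_intertwiner\<close> connects them.
\<close>

lemma partial_intertwiner_exists:
  assumes G: "proj G" "D * G = G * D" "I * G = G" "G \<noteq> 0"
    and H: "proj H" "D * H = H * D" "I * H = H"
    and tr: "\<And>w. tr (weval I D w * G) = tr (weval I D w * H)"
  obtains T where "\<And>x. gen D x * T = T * gen D x" "I * T = T" "T * I = T"
    "proj (adj T * T)" "proj (T * adj T)"
    "G * (adj T * T) = adj T * T" "H * (T * adj T) = T * adj T" "1 \<le> rtr (adj T * T)"
proof -
  interpret C: unital_generator G "D * G" by (rule cut_unital[OF G(1,2)])
  obtain e k d a where e: "proj e" "e \<noteq> 0" "e \<in> words_span G (D * G) k" "1 \<le> d"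
    and cs: "C.closed_system e d a"
    by (rule C.closed_system_exists[OF G(4)]) (erule that; assumption)
  have GG: "G * G = G" "adj G = G" and HH: "H * H = H" "adj H = H"
    using projD[OF G(1)] projD[OF H(1)] by auto
  interpret E: isometric_system e d "\<lambda>i. a i * e" using cs by (simp add: C.closed_system_def)
  obtain v where v: "v \<in> V k" "e = v * G" using cut_V_mem[OF G(1-3) e(3)] .
  have "\<exists>b. i < d \<longrightarrow> b \<in> V i \<and> a i = b * G" for i
    using cs cut_V_mem[OF G(1-3)] unfolding C.closed_system_def by metis
  then obtain b where b: "\<And>i. i < d \<Longrightarrow> b i \<in> V i" "\<And>i. i < d \<Longrightarrow> a i = b i * G" by metis
  have VG: "x * G = G * x" and VH: "x * H = H * x" if "x \<in> V l" for x l
    using V_commute[OF G(1-3) that] V_commute[OF H that] by auto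
  note transfer = relation_transfer[OF G(1-3) H tr]
  \<comment> \<open>A length large enough for both sides of every relation transferred below.\<close>
  define K where "K = 2 * k + 2 * d"
  have vK: "v \<in> V K" using v(1) by (rule V_mono) (simp add: K_def)
  have bvK: "b i * v \<in> V K" if "i < d" for i
    using V_mult[OF b(1)[OF that] v(1)] by (rule V_mono) (use that in \<open>simp add: K_def\<close>)
  define f where "f = v * H"
  have ff: "f * f = f"
  proof -
    have "v * v * G = v * G"
      using projD(2)[OF e(1)] unfolding v(2) by (metis GG(1) VG[OF v(1)] mult.assoc)
    then have "v * v * H = v * H"
      by (intro transfer[of _ K] vK V_mono[OF V_mult[OF v(1) v(1)]]) (auto simp: K_def)
    then show ?thesis unfolding f_def by (metis HH(1) VH[OF v(1)] mult.assoc)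
  qed
  have af: "adj f = f"
  proof -
    have "adj v * G = v * G"
      using projD(1)[OF e(1)] unfolding v(2) by (simp add: GG VG[OF V_adj[OF v(1)]])
    then have "adj v * H = v * H"
      by (rule transfer[OF V_adj[OF v(1)] v(1)])
    then show ?thesis by (simp add: f_def HH VH[OF V_adj[OF v(1)]])
  qed
  have pf: "proj f" using ff af by (simp add: proj_def)
  have f0: "f \<noteq> 0"
  proof
    assume "f = 0"
    then have "tr (v * H) = 0" by (simp add: f_def)
    moreover have "v \<in> {x. tr (x * G) = tr (x * H)}"
      by (intro V_induct[OF v(1)]) (auto simp: fmat.subspace_def distrib_right tr_add tr_smul tr)
    ultimately have "rtr e = 0" by (simp add: v(2) rtr_def)
    then show False using rtr_proj_ge_1[OF e(1,2)] by simp
  qed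
  have orth: "f * adj (b i) * b j * f = (if i = j then f else 0)" if ij: "i < d" "j < d" for i j
  proof -
    define y where "y = v * adj (b i) * b j * v"
    have "y \<in> V (k + i + j + k)"
      unfolding y_def by (intro V_mult V_adj v(1) b(1) ij)
    then have yK: "y \<in> V K" by (rule V_mono) (use ij in \<open>simp add: K_def\<close>)
    \<comment> \<open>Any projection that commutes with words may be collected at the right end.\<close>
    have cut: "(v * P) * adj (b i) * b j * (v * P) = y * P"
      if P: "P * P = P" "\<And>x l. x \<in> V l \<Longrightarrow> x * P = P * x" for P
    proof -
      have "adj (b i) * (b j * v) \<in> V (i + (j + k))" by (intro V_mult V_adj v(1) b(1) ij)
      then have "P * (adj (b i) * (b j * v)) = adj (b i) * (b j * v) * P" using P(2) by metis
      then show ?thesis unfolding y_def by (simp add: mult.assoc P(1))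
        (metis P(1) mult.assoc)
    qed
    have "adj (a i * e) * (a j * e) = (v * G) * adj (b i) * b j * (v * G)"
    proof -
      have "adj (a i * e) * (a j * e) = e * (G * adj (b i)) * (b j * G) * e"
        using projD(1)[OF e(1)] by (simp add: b(2) ij GG mult.assoc)
      moreover have "e * G = e" "G * e = e"
        unfolding v(2) by (metis GG(1) mult.assoc) (metis GG(1) VG[OF v(1)] mult.assoc)
      ultimately show ?thesis unfolding v(2)[symmetric] by (metis mult.assoc)
    qed
    then have "y * G = (if i = j then v else 0) * G"
      using E.S_orth[OF ij] cut[OF GG(1) VG] by (simp add: v(2))
    then have "y * H = (if i = j then v else 0) * H"
      using vK fmat.subspace_0[OF subspace_V] by (intro transfer[of _ K] yK) auto
    then show ?thesis using cut[OF HH(1) VH] by (simp add: f_def)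
  qed
  obtain c where c: "e * c = c" "adj c * c = matrix_unit 0 0" using proj_unit_column[OF e(1,2)] .
  obtain c' where c': "f * c' = c'" "adj c' * c' = matrix_unit 0 0" using proj_unit_column[OF pf f0] .
  have Gc: "G * c = c" using c(1) VG[OF v(1)] unfolding v(2) by (metis GG(1) mult.assoc)
  have Hc': "H * c' = c'" using c'(1) VH[OF v(1)] unfolding f_def by (metis HH(1) mult.assoc)
  have vc: "v * c = c" using c(1) unfolding v(2) by (simp add: mult.assoc Gc)
  have vc': "v * c' = c'" using c'(1) unfolding f_def by (simp add: mult.assoc Hc')
  define S where "S i = b i * c" for i
  define S' where "S' i = b i * c'" for i
  have Sa: "S i = a i * e * c" if "i < d" for i
    using b(2)[OF that] by (simp add: S_def mult.assoc c(1) Gc)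
  have "isometric_system (matrix_unit 0 0) d S"
  proof
    fix i j assume ij: "i < d" "j < d"
    have "adj (S i) * S j = adj c * (adj (a i * e) * (a j * e)) * c"
      using Sa ij by (simp add: mult.assoc)
    then show "adj (S i) * S j = (if i = j then matrix_unit 0 0 else 0)"
      unfolding E.S_orth[OF ij] by (auto simp: mult.assoc c)
  qed (auto simp: proj_matrix_unit S_def mult.assoc unit_column_times[OF c(2)])
  then interpret S: isometric_system "matrix_unit 0 0" d S .
  have "isometric_system (matrix_unit 0 0) d S'"
  proof
    fix i j assume ij: "i < d" "j < d"
    have "adj (f * c') = adj c'" using c'(1) by simp
    then have cf: "adj c' * f = adj c'" using af by simp
    have "adj (S' i) * S' j = (adj c' * f) * adj (b i) * b j * (f * c')"
      unfolding cf c'(1) by (simp add: S'_def mult.assoc)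
    also have "\<dots> = adj c' * (f * adj (b i) * b j * f) * c'" by (simp add: mult.assoc)
    finally show "adj (S' i) * S' j = (if i = j then matrix_unit 0 0 else 0)"
      unfolding orth[OF ij] by (auto simp: mult.assoc c')
  qed (auto simp: proj_matrix_unit S'_def mult.assoc unit_column_times[OF c'(2)])
  then interpret S': isometric_system "matrix_unit 0 0" d S' .
  have rel: "\<exists>z. gen D x * S i = (\<Sum>j<d. z j *\<^sub>C S j) \<and> gen D x * S' i = (\<Sum>j<d. z j *\<^sub>C S' j)"
    if i: "i < d" for x i
  proof -
    obtain z where z: "gen (D * G) x * (a i * e) = (\<Sum>j<d. z j *\<^sub>C (a j * e))"
      using C.closed_system_coeffs[OF cs i] by blast
    have 1: "gen D x * (b i * v) * G = (\<Sum>j<d. z j *\<^sub>C (b j * v)) * G"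
    proof -
      have ae: "a j * e = b j * v * G" if "j < d" for j
        using VG[OF v(1)] b(2)[OF that] unfolding v(2) by (metis GG(1) mult.assoc)
      have "gen (D * G) x * (a i * e) = gen D x * (G * (b i * v)) * G"
        by (simp add: cut_gen[OF G(1,2)] ae[OF i] mult.assoc)
      also have "\<dots> = gen D x * (b i * v) * G"
        using VG[OF bvK[OF i]] by (metis GG(1) mult.assoc)
      finally show ?thesis using z ae by (simp add: sum_distrib_right)
    qed
    have "gen D x * (b i * v) \<in> V (1 + (i + k))" by (intro V_mult V_gen v(1) b(1) i)
    then have "gen D x * (b i * v) \<in> V K" by (rule V_mono) (use i in \<open>simp add: K_def\<close>)
    moreover have "(\<Sum>j<d. z j *\<^sub>C (b j * v)) \<in> V K" by (intro V_sum V_smul bvK) simp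
    ultimately have 2: "gen D x * (b i * v) * H = (\<Sum>j<d. z j *\<^sub>C (b j * v)) * H"
      using 1 by (rule transfer)
    have "gen D x * S i = gen D x * (b i * v) * G * c" by (simp add: S_def mult.assoc Gc vc)
    also have "\<dots> = (\<Sum>j<d. z j *\<^sub>C S j)"
      unfolding 1 by (simp add: S_def sum_distrib_right mult.assoc Gc vc)
    finally have 3: "gen D x * S i = (\<Sum>j<d. z j *\<^sub>C S j)" .
    have "gen D x * S' i = gen D x * (b i * v) * H * c'" by (simp add: S'_def mult.assoc Hc' vc')
    also have "\<dots> = (\<Sum>j<d. z j *\<^sub>C S' j)"
      unfolding 2 by (simp add: S'_def sum_distrib_right mult.assoc Hc' vc')
    finally show ?thesis using 3 by blast
  qed
  define T where "T = (\<Sum>i<d. S' i * adj (S i))"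
  note TT = isometric_intertwiner[OF S.isometric_system_axioms S'.isometric_system_axioms, folded T_def]
  have comm: "gen D x * T = T * gen D x" for x
  proof (rule TT(3))
    fix i assume i: "i < d"
    show "S'.range_proj * (gen D x * S' i) = gen D x * S' i"
      using rel[OF i, of x] S'.coeffs_range(1) by blast
    show "S.range_proj * (adj (gen D x) * S i) = adj (gen D x) * S i"
      unfolding adj_gen using rel[OF i, of "swap_letter x"] S.coeffs_range(1) by blast
  next
    fix i j assume ij: "i < d" "j < d"
    obtain z where "gen D x * S j = (\<Sum>j<d. z j *\<^sub>C S j)" "gen D x * S' j = (\<Sum>j<d. z j *\<^sub>C S' j)"
      using rel[OF ij(2), of x] by blast
    then show "\<exists>c. adj (S i) * (gen D x * S j) = c *\<^sub>C matrix_unit 0 0 \<and>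
        adj (S' i) * (gen D x * S' j) = c *\<^sub>C matrix_unit 0 0"
      using S.coeffs_range(2)[OF _ ij(1)] S'.coeffs_range(2)[OF _ ij(1)] by blast
  qed
  have Ib: "I * b i = b i" if "i < d" for i using I_V[OF b(1)[OF that]] .
  have IS: "I * S i = S i" "I * S' i = S' i" if "i < d" for i
    using Ib[OF that] by (auto simp: S_def S'_def mult.assoc[symmetric])
  have SI: "adj (S i) * I = adj (S i)" if "i < d" for i
  proof -
    have "adj (I * S i) = adj (S i)" using IS(1)[OF that] by simp
    then show ?thesis using projD(1)[OF proj_I] by simp
  qed
  have GS: "G * S i = S i" if "i < d" for i
    unfolding S_def using VG[OF b(1)[OF that]] by (metis Gc mult.assoc)
  have HS: "H * S' i = S' i" if "i < d" for i
    unfolding S'_def using VH[OF b(1)[OF that]] by (metis Hc' mult.assoc)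
  show ?thesis
  proof (rule that[of T])
    show "gen D x * T = T * gen D x" for x by (rule comm)
    show "I * T = T" using IS(2) by (simp add: T_def sum_distrib_left mult.assoc[symmetric])
    show "T * I = T" using SI by (simp add: T_def sum_distrib_right mult.assoc)
    show "proj (adj T * T)" "proj (T * adj T)"
      using S.proj_range_proj S'.proj_range_proj by (simp_all add: TT(1,2))
    show "G * (adj T * T) = adj T * T"
      unfolding TT(1) using GS by (simp add: S.range_proj_def sum_distrib_left mult.assoc[symmetric])
    show "H * (T * adj T) = T * adj T"
      unfolding TT(2) using HS by (simp add: S'.range_proj_def sum_distrib_left mult.assoc[symmetric])
    show "1 \<le> rtr (adj T * T)"
      unfolding TT(1) using e(4) by (simp add: S.rtr_range_proj rtr_matrix_unit)
  qed
qed

end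

text \<open>
  The initial and final projections of a nonzero partial intertwiner are subtracted from \<open>G\<close> and \<open>H\<close>. Both have
  the same traces against all words, since the intertwiner commutes with words and the trace is cyclic; so
  the remainders satisfy the hypotheses again, and the partial isometries obtained are added up.
\<close>

lemma commuting_projections_equivalent:
  assumes "unital_generator I D"
    and "proj G" "D * G = G * D" "I * G = G" and "proj H" "D * H = H * D" "I * H = H"
    and "\<And>w. tr (weval I D w * G) = tr (weval I D w * H)"
  shows "\<exists>T. D * T = T * D \<and> adj T * T = G \<and> T * adj T = H"
proof -
  interpret unital_generator I D by (rule assms(1))
  have *: "\<lbrakk>proj G; D * G = G * D; I * G = G; proj H; D * H = H * D; I * H = H;
      \<And>w. tr (weval I D w * G) = tr (weval I D w * H); rtr G < real m\<rbrakk>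
    \<Longrightarrow> \<exists>T. D * T = T * D \<and> adj T * T = G \<and> T * adj T = H" for m G H
  proof (induction m arbitrary: G H)
    case 0
    then show ?case using rtr_proj_nonneg[of G] by simp
  next
    case (Suc m)
    note G = Suc.prems(1-3) and H = Suc.prems(4-6) and tr = Suc.prems(7)
    show ?case
    proof (cases "G = 0")
      case True
      have "tr (adj H * H) = 0"
        using tr[of "[]"] True G(3) H projD[OF H(1)] by simp
      then have "H = 0" by (rule tr_adj_mult_eq_0)
      then show ?thesis using True by (intro exI[of _ 0]) simp
    next
      case False
      obtain T where T: "\<And>x. gen D x * T = T * gen D x" "I * T = T" "T * I = T"
        "proj (adj T * T)" "proj (T * adj T)"
        "G * (adj T * T) = adj T * T" "H * (T * adj T) = T * adj T" "1 \<le> rtr (adj T * T)"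
        using partial_intertwiner_exists[OF G False H tr] by blast
      define F where "F = adj T * T"
      define F' where "F' = T * adj T"
      have DT: "D * T = T * D" "adj D * T = T * adj D" using T(1)[of Lx] T(1)[of Ly] by auto
      have DT': "D * adj T = adj T * D"
      proof -
        have "adj (adj D * T) = adj (T * adj D)" using DT by simp
        then show ?thesis by simp
      qed
      have DF: "D * F = F * D" "D * F' = F' * D"
        unfolding F_def F'_def by (metis DT(1) DT' mult.assoc)+
      have IT': "I * adj T = adj T"
      proof -
        have "adj (T * I) = adj T" using T(3) by simp
        then show ?thesis using projD(1)[OF proj_I] by simp
      qed
      have IF: "I * F = F" "I * F' = F'"
        by (simp_all add: F_def F'_def mult.assoc[symmetric] T(2) IT')
      have wT: "weval I D w * T = T * weval I D w" for w
      proof (induction w)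
        case (Cons y w)
        then show ?case using T(1)[of y] by (metis mult.assoc weval.simps(2))
      qed (simp add: T(2,3))
      have trF: "tr (weval I D w * F) = tr (weval I D w * F')" for w
      proof -
        have "tr (weval I D w * F) = tr (T * (weval I D w * adj T))"
          by (subst tr_mult_commute[of T]) (simp add: F_def mult.assoc)
        also have "\<dots> = tr (weval I D w * F')"
          by (simp add: F'_def mult.assoc[symmetric] wT)
        finally show ?thesis .
      qed
      have "\<exists>T2. D * T2 = T2 * D \<and> adj T2 * T2 = G - F \<and> T2 * adj T2 = H - F'"
      proof (rule Suc.IH)
        show "proj (G - F)" "proj (H - F')"
          using T(4-7) by (auto intro!: proj_diff G(1) H(1) simp: F_def F'_def)
        show "D * (G - F) = (G - F) * D" "D * (H - F') = (H - F') * D"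
          using DF G(2) H(2) by (auto simp: right_diff_distrib left_diff_distrib)
        show "I * (G - F) = G - F" "I * (H - F') = H - F'"
          using IF G(3) H(3) by (auto simp: right_diff_distrib)
        show "tr (weval I D w * (G - F)) = tr (weval I D w * (H - F'))" for w
          using tr trF by (simp add: right_diff_distrib tr_diff)
        show "rtr (G - F) < real m"
          using T(8) Suc.prems(8) by (simp add: rtr_diff F_def)
      qed
      then obtain T2 where T2: "D * T2 = T2 * D" "adj T2 * T2 = G - F" "T2 * adj T2 = H - F'"
        by blast
      have pT: "T * F = T" using partial_isometry[OF T(4)] by (simp add: F_def)
      have pGF: "proj (G - F)" using T(4,6) by (auto intro!: proj_diff G(1) simp: F_def)
      have pT2: "T2 * (G - F) = T2" using partial_isometry[of T2] pGF by (simp add: T2(2))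
      have pT': "F' * T = T" using pT by (simp add: F_def F'_def mult.assoc)
      have pT2': "(H - F') * T2 = T2" using pT2 T2(2) by (simp add: T2(3)[symmetric] mult.assoc)
      have "F * (G - F) = 0"
        using projD[OF T(4)] proj_absorb_swap[OF G(1) T(4,6)]
        by (simp add: F_def[symmetric] right_diff_distrib)
      then have "T * F * ((G - F) * adj T2) = 0"
        by (metis mult.assoc mult_zero_left mult_zero_right)
      moreover have "(G - F) * adj T2 = adj T2"
      proof -
        have "adj (T2 * (G - F)) = adj T2" using pT2 by simp
        then show ?thesis using projD(1)[OF pGF] by (simp only: adj_mult)
      qed
      ultimately have x1: "T * adj T2 = 0" by (simp add: pT)
      have x1': "T2 * adj T = 0"
      proof -
        have "adj (T * adj T2) = 0" by (simp only: x1 adj_zero)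
        then show ?thesis by simp
      qed
      have "F' * (H - F') = 0"
        using projD[OF T(5)] proj_absorb_swap[OF H(1) T(5,7)]
        by (simp add: F'_def[symmetric] right_diff_distrib)
      then have "adj T * F' * ((H - F') * T2) = 0"
        by (metis mult.assoc mult_zero_left mult_zero_right)
      moreover have "adj T * F' = adj T"
      proof -
        have "adj (F' * T) = adj T" using pT' by simp
        then show ?thesis using projD(1)[OF T(5)] by (simp add: F'_def)
      qed
      ultimately have x2: "adj T * T2 = 0" by (simp add: pT2')
      have x2': "adj T2 * T = 0"
      proof -
        have "adj (adj T * T2) = 0" by (simp only: x2 adj_zero)
        then show ?thesis by simp
      qed
      have "D * (T + T2) = (T + T2) * D" by (simp add: distrib_left distrib_right DT T2(1))
      moreover have "adj (T + T2) * (T + T2) = G"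
        by (simp add: distrib_left distrib_right x2 x2' T2(2) F_def)
      moreover have "(T + T2) * adj (T + T2) = H"
        by (simp add: distrib_left distrib_right x1 x1' T2(3) F'_def)
      ultimately show ?thesis by blast
    qed
  qed
  obtain m where "rtr G < real m" using reals_Archimedean2 by blast
  with * assms(2-8) show ?thesis by blast
qed

text \<open>
  By induction every word has a representative in \<open>V l\<close> that equals it both on \<open>G\<close> and on \<open>H\<close>. Prefixing
  a letter raises the length to \<open>l + 1\<close>; the length bound on \<open>G\<close> provides a shorter representative there,
  and this relation of length \<open>l + 1\<close> is transferred to \<open>H\<close> by traces of length \<open>2 * l + 2\<close>.
\<close>

lemma (in unital_generator) traces_agree_on_all_words:
  assumes G: "proj G" "D * G = G * D" "I * G = G"
    and H: "proj H" "D * H = H * D" "I * H = H"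
    and len: "\<And>w. weval G (D * G) w \<in> words_span G (D * G) l"
    and tr: "\<And>w. length w \<le> 2 * l + 2 \<Longrightarrow> tr (weval I D w * G) = tr (weval I D w * H)"
  shows "tr (weval I D w * G) = tr (weval I D w * H)"
proof -
  interpret C: unital_generator G "D * G" by (rule cut_unital[OF G(1,2)])
  have transfer: "y * H = z * H" if "y \<in> V (l + 1)" "z \<in> V (l + 1)" "y * G = z * G" for y z
    by (rule relation_transfer[OF G H tr that]) simp
  have "\<exists>p\<in>V l. weval I D w * G = p * G \<and> weval I D w * H = p * H"
  proof (induction w)
    case Nil
    show ?case using V_I by force
  next
    case (Cons x w)
    then obtain p where p: "p \<in> V l" "weval I D w * G = p * G" "weval I D w * H = p * H" by blast
    have xp: "gen D x * p \<in> V (l + 1)" using V_mult[OF V_gen p(1), of x] by simp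
    have "gen D x * p * G \<in> words_span G (D * G) (l + 1)" by (rule mem_cut_V[OF G xp])
    then have "gen D x * p * G \<in> words_span G (D * G) l"
      by (rule C.V_induct[OF _ C.subspace_V]) (rule len)
    then obtain q where q: "q \<in> V l" "gen D x * p * G = q * G" using cut_V_mem[OF G] by metis
    have "gen D x * p * H = q * H"
      by (rule transfer[OF xp V_mono[OF q(1)] q(2)]) simp
    then show ?case using p q by (intro bexI[of _ q]) (auto simp: mult.assoc)
  qed
  then obtain p where p: "p \<in> V l" "weval I D w * G = p * G" "weval I D w * H = p * H" by blast
  have "p \<in> {x. tr (x * G) = tr (x * H)}"
    by (intro V_induct[OF p(1)]) (auto simp: fmat.subspace_def distrib_right tr_add tr_smul tr)
  then show ?thesis using p by simp
qed

section \<open>Blocks\<close>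

text \<open>
  The \<open>n\<close> by \<open>n\<close> matrix \<open>M\<close> placed at the block position \<open>(p, q)\<close> of an infinite block matrix. The first two
  conditions follow from the other two for \<open>n > 0\<close>; they keep the support finite for \<open>n = 0\<close>.
\<close>

lift_definition block :: "nat \<Rightarrow> nat \<Rightarrow> nat \<Rightarrow> complex mat \<Rightarrow> fmat" is
  "\<lambda>n p q M i j. if i < Suc p * n \<and> j < Suc q * n \<and> i div n = p \<and> j div n = q
    then M $$ (i mod n, j mod n) else 0"
proof -
  fix n p q and M :: "complex mat"
  show "\<exists>N. \<forall>i j. N \<le> i \<or> N \<le> j \<longrightarrow> (if i < Suc p * n \<and> j < Suc q * n \<and> i div n = p \<and> j div n = q
    then M $$ (i mod n, j mod n) else 0) = 0"
    by (rule exI[of _ "max (Suc p * n) (Suc q * n)"]) auto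
qed

context
  fixes n :: nat
  assumes n: "0 < n"
begin

lemma div_eq_imp_less: "i div n = p \<Longrightarrow> i < Suc p * n"
  using n by (metis dividend_less_div_times mult.commute mult_Suc)

lemma entry_block:
  "entry (block n p q M) i j = (if i div n = p \<and> j div n = q then M $$ (i mod n, j mod n) else 0)"
  using div_eq_imp_less[of i p] div_eq_imp_less[of j q] by (auto simp: block.rep_eq)

lemma supp_below_block: "supp_below (Suc (max p q) * n) (block n p q M)"
proof -
  have "Suc p * n \<le> Suc (max p q) * n" "Suc q * n \<le> Suc (max p q) * n"
    by (intro mult_le_mono1; simp)+
  then show ?thesis unfolding supp_below_def block.rep_eq by (metis order_trans not_le)
qed

lemma sum_block_index:
  assumes "\<And>k. k div n \<noteq> p \<Longrightarrow> f k = 0" "Suc p * n \<le> N"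
  shows "(\<Sum>k<N. f k) = (\<Sum>l<n. f (p * n + l) :: complex)"
proof -
  have "(\<Sum>k<N. f k) = (\<Sum>k\<in>{p * n..<p * n + n}. f k)"
  proof (rule sum.mono_neutral_right)
    show "\<forall>k\<in>{..<N} - {p * n..<p * n + n}. f k = 0"
    proof
      fix k assume "k \<in> {..<N} - {p * n..<p * n + n}"
      then have "k div n \<noteq> p"
        using n div_times_less_eq_dividend[of k n] div_eq_imp_less[of k p] by auto
      then show "f k = 0" by (rule assms(1))
    qed
  qed (use assms(2) in auto)
  also have "\<dots> = (\<Sum>l<n. f (p * n + l))"
    by (rule sum.reindex_bij_witness[of _ "\<lambda>l. p * n + l" "\<lambda>k. k - p * n"]) auto
  finally show ?thesis .
qed

lemma block_times:
  assumes "M \<in> carrier_mat n n" "N \<in> carrier_mat n n"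
  shows "block n p q M * block n q s N = block n p s (M * N)"
proof (rule fmat_eqI)
  fix i j
  have "entry (block n p q M * block n q s N) i j
    = (\<Sum>k<Suc (max p q) * n. entry (block n p q M) i k * entry (block n q s N) k j)"
    by (rule entry_times[OF supp_below_block])
  also have "\<dots> = (\<Sum>l<n. entry (block n p q M) i (q * n + l) * entry (block n q s N) (q * n + l) j)"
  proof (rule sum_block_index)
    show "Suc q * n \<le> Suc (max p q) * n" by (intro mult_le_mono1) simp
  qed (simp add: entry_block)
  also have "\<dots> = entry (block n p s (M * N)) i j"
    using assms n by (auto simp: entry_block scalar_prod_def atLeast0LessThan)
  finally show "entry (block n p q M * block n q s N) i j = entry (block n p s (M * N)) i j" .
qed

lemma block_times_zero:
  assumes "q \<noteq> r"
  shows "block n p q M * block n r s N = 0"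
  by (rule fmat_eqI)
    (use assms in \<open>auto simp: entry_times[OF supp_below_block] entry_block intro!: sum.neutral\<close>)

lemma adj_block:
  assumes "M \<in> carrier_mat n n"
  shows "adj (block n p q M) = block n q p (mat_adjoint M)"
  using assms n by (intro fmat_eqI) (auto simp: entry_block mat_adjoint_conjugate_transpose)

lemma tr_block:
  assumes "M \<in> carrier_mat n n"
  shows "tr (block n p p M) = mat_trace M"
proof -
  have "tr (block n p p M) = (\<Sum>i<Suc (max p p) * n. entry (block n p p M) i i)"
    by (rule tr_eq[OF supp_below_block])
  also have "\<dots> = (\<Sum>l<n. entry (block n p p M) (p * n + l) (p * n + l))"
    by (rule sum_block_index) (auto simp: entry_block)
  also have "\<dots> = mat_trace M"
    using assms n by (auto simp: entry_block mat_trace_def)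
  finally show ?thesis .
qed

lemma block_inject:
  assumes "M \<in> carrier_mat n n" "N \<in> carrier_mat n n" "block n p q M = block n p q N"
  shows "M = N"
proof (rule eq_matI)
  fix i j assume "i < dim_row N" "j < dim_col N"
  then have "i < n" "j < n" using assms(2) by auto
  then have "entry (block n p q M) (p * n + i) (q * n + j) = M $$ (i, j)"
    "entry (block n p q N) (p * n + i) (q * n + j) = N $$ (i, j)"
    using n by (auto simp: entry_block)
  then show "M $$ (i, j) = N $$ (i, j)" using assms(3) by simp
qed (use assms in auto)

lemma block_exists:
  assumes "block n p p (1\<^sub>m n) * T = T" "T * block n q q (1\<^sub>m n) = T"
  obtains M where "M \<in> carrier_mat n n" "T = block n p q M"
proof -
  define M where "M = mat n n (\<lambda>(i, j). entry T (p * n + i) (q * n + j))"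
  have row: "entry T i j = 0" if "i div n \<noteq> p" for i j
  proof -
    have "entry T i j = entry (block n p p (1\<^sub>m n) * T) i j" by (simp add: assms(1))
    also have "\<dots> = 0"
      using that by (simp add: entry_times[OF supp_below_block] entry_block)
    finally show ?thesis .
  qed
  have col: "entry T i j = 0" if "j div n \<noteq> q" for i j
  proof -
    obtain N where "supp_below N T" using supp_below_exists by blast
    have "entry T i j = entry (T * block n q q (1\<^sub>m n)) i j" by (simp add: assms(2))
    also have "\<dots> = 0"
      using that by (simp add: entry_times[OF \<open>supp_below N T\<close>] entry_block)
    finally show ?thesis .
  qed
  have "T = block n p q M"
  proof (rule fmat_eqI)
    fix i j
    have "M $$ (i mod n, j mod n) = entry T (i div n * n + i mod n) (j div n * n + j mod n)"
      if "i div n = p" "j div n = q"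
      unfolding M_def using n that by simp
    then show "entry T i j = entry (block n p q M) i j"
      using row col by (auto simp: entry_block)
  qed
  then show ?thesis by (intro that[of M]) (auto simp: M_def)
qed

lemma mat_trace_commute:
  assumes "M \<in> carrier_mat n n" "N \<in> carrier_mat n n"
  shows "mat_trace (M * N) = mat_trace (N * M)"
  using tr_mult_commute[of "block n 0 0 M" "block n 0 0 N"] assms
  by (simp add: block_times tr_block[of "_ * _"])

end

lemma mat_adjoint_carrier [simp]:
  "(M :: complex mat) \<in> carrier_mat n m \<Longrightarrow> mat_adjoint M \<in> carrier_mat m n"
  by (auto simp: mat_adjoint_conjugate_transpose)

lemma mat_adjoint_adjoint [simp]: "mat_adjoint (mat_adjoint M) = (M :: complex mat)"
  by (rule eq_matI) (auto simp: mat_adjoint_conjugate_transpose)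

lemma mat_adjoint_times:
  fixes M N :: "complex mat"
  assumes "0 < n" "M \<in> carrier_mat n n" "N \<in> carrier_mat n n"
  shows "mat_adjoint (M * N) = mat_adjoint N * mat_adjoint M"
proof -
  have "block n 0 0 (mat_adjoint (M * N)) = adj (block n 0 0 (M * N))"
    using adj_block[OF assms(1) mult_carrier_mat[OF assms(2,3)]] by simp
  also have "block n 0 0 (M * N) = block n 0 0 M * block n 0 0 N"
    using block_times[OF assms] by simp
  also have "adj \<dots> = block n 0 0 (mat_adjoint N * mat_adjoint M)"
    unfolding adj_mult using assms by (simp add: block_times[OF assms(1)] adj_block[OF assms(1)])
  finally show ?thesis
    by (rule block_inject[OF assms(1), rotated 2])
      (simp_all add: assms mult_carrier_mat[of _ n n _ n])
qed

section \<open>From words to unitary similarity\<close>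

lemma word_eval_carrier:
  assumes "P \<in> carrier_mat n n" "Q \<in> carrier_mat n n"
  shows "word_eval n w P Q \<in> carrier_mat n n"
proof (induction w)
  case (Cons x w)
  then show ?case using assms by (cases x) auto
qed simp

lemma unitarily_similar_imp_traces:
  assumes n: "0 < n" and A: "A \<in> carrier_mat n n" and sim: "unitarily_similar n A B"
  shows "mat_trace (word_eval n w A (mat_adjoint A)) = mat_trace (word_eval n w B (mat_adjoint B))"
proof -
  note mc = mult_carrier_mat[of _ n n _ n]
  obtain U where U: "U \<in> carrier_mat n n" "unitary_mat U" and B: "B = mat_adjoint U * A * U"
    using sim by (auto simp: unitarily_similar_def)
  have UU: "U * mat_adjoint U = 1\<^sub>m n" "mat_adjoint U * U = 1\<^sub>m n"
    using U by (auto simp: unitary_mat_def)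
  have U': "mat_adjoint U \<in> carrier_mat n n" and A': "mat_adjoint A \<in> carrier_mat n n"
    using U A by auto
  have conj: "(mat_adjoint U * X * U) * (mat_adjoint U * Y * U) = mat_adjoint U * (X * Y) * U"
    if "X \<in> carrier_mat n n" "Y \<in> carrier_mat n n" for X Y
  proof -
    have "(mat_adjoint U * X * U) * (mat_adjoint U * Y * U)
      = mat_adjoint U * X * (U * mat_adjoint U) * (Y * U)"
      using U(1) U' that by (simp add: mc assoc_mult_mat[of _ n n _ n _ n])
    then show ?thesis
      unfolding UU using U(1) U' that by (simp add: mc assoc_mult_mat[of _ n n _ n _ n])
  qed
  have B': "mat_adjoint B = mat_adjoint U * mat_adjoint A * U"
    unfolding B using U(1) U' A A'
    by (simp add: mc mat_adjoint_times[OF n] assoc_mult_mat[of _ n n _ n _ n])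
  note wc = word_eval_carrier[OF A A']
  have "word_eval n w B (mat_adjoint B) = mat_adjoint U * word_eval n w A (mat_adjoint A) * U"
  proof (induction w)
    case Nil
    then show ?case using U' UU(2) by simp
  next
    case (Cons x w)
    have "B * (mat_adjoint U * word_eval n w A (mat_adjoint A) * U)
        = mat_adjoint U * (A * word_eval n w A (mat_adjoint A)) * U"
      unfolding B by (rule conj[OF A wc])
    moreover have "mat_adjoint B * (mat_adjoint U * word_eval n w A (mat_adjoint A) * U)
        = mat_adjoint U * (mat_adjoint A * word_eval n w A (mat_adjoint A)) * U"
      unfolding B' by (rule conj[OF A' wc])
    ultimately show ?case by (cases x) (simp_all add: Cons.IH)
  qed
  also have "mat_trace \<dots> = mat_trace (U * (mat_adjoint U * word_eval n w A (mat_adjoint A)))"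
    by (rule mat_trace_commute[OF n]) (simp_all add: mc U(1) U' wc)
  also have "U * (mat_adjoint U * word_eval n w A (mat_adjoint A)) = word_eval n w A (mat_adjoint A)"
    using U(1) U' wc[of w] UU(1) by (simp add: mc assoc_mult_mat[of _ n n _ n _ n, symmetric])
  finally show ?thesis by simp
qed

text \<open>
  The block diagonal sum of \<open>A\<close> and \<open>B\<close> evaluates words on both matrices at once. An equivalence of the two
  block projections that commutes with it has a single nonzero block \<open>M\<close>, which is unitary and satisfies
  \<open>B * M = M * A\<close>; the adjoint of \<open>M\<close> is then the matrix in the definition of unitary similarity.
\<close>

lemma traces_imp_unitarily_similar:
  assumes n: "0 < n" and A: "A \<in> carrier_mat n n" and B: "B \<in> carrier_mat n n"
    and l: "real n * log 2 (real n) + 2 * real n - 2 \<le> real l"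
    and traces: "\<And>w. length w \<le> 2 * l + 2 \<Longrightarrow>
      mat_trace (word_eval n w A (mat_adjoint A)) = mat_trace (word_eval n w B (mat_adjoint B))"
  shows "unitarily_similar n A B"
proof -
  note mc = mult_carrier_mat[of _ n n _ n]
  note bt = block_times[OF n] and bz = block_times_zero[OF n] and ab = adj_block[OF n]
  have A': "mat_adjoint A \<in> carrier_mat n n" and B': "mat_adjoint B \<in> carrier_mat n n"
    using A B by auto
  have adj1: "mat_adjoint (1\<^sub>m n) = (1\<^sub>m n :: complex mat)"
    by (rule eq_matI) (auto simp: mat_adjoint_conjugate_transpose)
  define G where "G = block n 0 0 (1\<^sub>m n)"
  define H where "H = block n 1 1 (1\<^sub>m n)"
  define D where "D = block n 0 0 A + block n 1 1 B"
  have pG: "proj G" and pH: "proj H"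
    by (simp_all add: proj_def G_def H_def bt ab adj1)
  have GH: "G * H = 0" "H * G = 0" by (simp_all add: G_def H_def bz)
  have DG: "D * G = block n 0 0 A" "G * D = block n 0 0 A"
    using A B by (simp_all add: D_def G_def distrib_left distrib_right bt bz)
  have DH: "D * H = block n 1 1 B" "H * D = block n 1 1 B"
    using A B by (simp_all add: D_def H_def distrib_left distrib_right bt bz)
  have ug: "unital_generator (G + H) D"
  proof
    show "proj (G + H)"
      using pG pH GH by (simp add: proj_def distrib_left distrib_right)
    show "(G + H) * D = D" "D * (G + H) = D"
      by (simp_all add: distrib_left distrib_right DG DH) (simp_all add: D_def)
  qed
  then interpret unital_generator "G + H" D .
  have G: "proj G" "D * G = G * D" "(G + H) * G = G"
    and H: "proj H" "D * H = H * D" "(G + H) * H = H"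
    using pG pH by (auto simp: DG DH distrib_right GH projD)
  note wA = word_eval_carrier[OF A A'] and wB = word_eval_carrier[OF B B']
  have w: "weval (G + H) D w = block n 0 0 (word_eval n w A (mat_adjoint A))
      + block n 1 1 (word_eval n w B (mat_adjoint B))" for w
  proof (induction w)
    case Nil
    show ?case by (simp add: G_def H_def)
  next
    case (Cons x w)
    show ?case
      using A B A' B' wA[of w] wB[of w]
      by (cases x; simp add: Cons.IH; simp add: D_def distrib_left distrib_right bt bz ab)
  qed
  have wG: "tr (weval (G + H) D w * G) = mat_trace (word_eval n w A (mat_adjoint A))" for w
    using wA[of w] unfolding w by (simp add: G_def distrib_right bt bz tr_block[OF n])
  have wH: "tr (weval (G + H) D w * H) = mat_trace (word_eval n w B (mat_adjoint B))" for w
    using wB[of w] unfolding w by (simp add: H_def distrib_right bt bz tr_block[OF n])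
  have rG: "rtr G = real n"
    by (simp add: rtr_def G_def tr_block[OF n] mat_trace_def)
  have len: "weval G (D * G) w \<in> words_span G (D * G) l" for w
    using n rG l by (intro words_span_stable[of _ _ n] cut_unital G) auto
  have "tr (weval (G + H) D w * G) = tr (weval (G + H) D w * H)" for w
    by (rule traces_agree_on_all_words[OF G H len]) (simp add: wG wH traces)
  then obtain T where T: "D * T = T * D" "adj T * T = G" "T * adj T = H"
    using commuting_projections_equivalent[OF ug G H] by blast
  have TG: "T * G = T" using partial_isometry[of T] pG by (simp add: T(2))
  have HT: "H * T = T" using TG by (simp add: T(2,3)[symmetric] mult.assoc)
  obtain M where M: "M \<in> carrier_mat n n" "T = block n 1 0 M"
    using block_exists[OF n, of 1 T 0] TG HT unfolding G_def H_def by blast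
  have M': "mat_adjoint M \<in> carrier_mat n n" using M(1) by simp
  have "block n 0 0 (mat_adjoint M * M) = block n 0 0 (1\<^sub>m n)"
    using T(2) M M' by (simp add: ab bt G_def)
  then have MM: "mat_adjoint M * M = 1\<^sub>m n"
    by (rule block_inject[OF n, rotated 2]) (simp_all add: mc M(1) M')
  have "block n 1 1 (M * mat_adjoint M) = block n 1 1 (1\<^sub>m n)"
    using T(3) M M' by (simp add: ab bt H_def)
  then have MM': "M * mat_adjoint M = 1\<^sub>m n"
    by (rule block_inject[OF n, rotated 2]) (simp_all add: mc M(1) M')
  have "block n 1 0 (B * M) = block n 1 0 (M * A)"
    using T(1) M A B by (simp add: D_def distrib_left distrib_right bt bz)
  then have BM: "B * M = M * A"
    by (rule block_inject[OF n, rotated 2]) (simp_all add: mc M(1) A B)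
  have "B = B * (M * mat_adjoint M)" using B by (simp add: MM')
  also have "\<dots> = M * A * mat_adjoint M"
    using B M(1) M' by (simp add: mc BM[symmetric] assoc_mult_mat[of _ n n _ n _ n])
  finally have "B = mat_adjoint (mat_adjoint M) * A * mat_adjoint M" by simp
  moreover have "unitary_mat (mat_adjoint M)"
    by (simp add: unitary_mat_def carrier_matD[OF M'] MM MM')
  ultimately show ?thesis unfolding unitarily_similar_def using M' by blast
qed

lemma specht_words_suffice_bound:
  assumes "0 < n" "real n * log 2 (real n) + 2 * real n - 2 \<le> real l"
  shows "specht_words_suffice n (2 * l + 2)"
  unfolding specht_words_suffice_def words_upto_def
  using unitarily_similar_imp_traces[OF assms(1)] traces_imp_unitarily_similar[OF assms(1) _ _ assms(2)]
  by blast

section \<open>Numerical estimates\<close>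

text \<open>
  For \<open>x > 4\<close> the logarithm is bounded by its tangent at 4, using \<open>ln 2 \<ge> 1 / 2\<close>; for \<open>x \<le> 4\<close> it is at
  most 2.
\<close>

lemma two_log2_le:
  assumes "1 \<le> (x :: real)"
  shows "2 * log 2 x \<le> x + 3"
proof (cases "x \<le> 4")
  case True
  have "log 2 x \<le> log 2 4" using assms True by (intro log_mono) auto
  also have "log 2 4 = (2::real)" using log_pow_cancel[of 2 2] by simp
  finally show ?thesis using assms by linarith
next
  case False
  have "ln (x / 4) \<le> x / 4 - 1" using False by (intro ln_le_minus_one) auto
  moreover have "ln (2::real) \<ge> 1 / 2"
    using ln_le_minus_one[of "1 / 2 :: real"] by (simp add: ln_div)
  moreover have "log 2 (x / 4) * ln 2 = ln (x / 4)" by (simp add: log_def)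
  moreover have "0 \<le> log 2 (x / 4)" using False by simp
  ultimately have "log 2 (x / 4) * (1 / 2) \<le> x / 4 - 1"
    by (smt (verit) mult_left_mono)
  moreover have "log 2 (x / 4) = log 2 x - 2"
    using False log_pow_cancel[of 2 2] by (simp add: log_divide)
  ultimately show ?thesis by simp
qed

lemma terseness_bound:
  assumes "n > 1"
  shows "real (terseness n) \<le> 2 * real n * log 2 (real n) + 4 * real n"
proof -
  define b where "b = real n * log 2 (real n) + 2 * real n - 2"
  have "0 \<le> real n * log 2 (real n)" using assms by simp
  then have b0: "0 \<le> b" using assms unfolding b_def by linarith
  define l where "l = nat \<lceil>b\<rceil>"
  have l: "b \<le> real l" "real l \<le> b + 1" using b0 by (auto simp: l_def)
  have "specht_words_suffice n (2 * l + 2)"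
    using assms l(1) by (intro specht_words_suffice_bound) (auto simp: b_def)
  then have "terseness n \<le> 2 * l + 2" unfolding terseness_def by (rule Least_le)
  then have "real (terseness n) \<le> 2 * real l + 2" by linarith
  also have "\<dots> \<le> 2 * (b + 1) + 2" using l(2) by simp
  finally show ?thesis by (simp add: b_def algebra_simps)
qed

lemma card_words_upto: "card (words_upto k) \<le> 2 ^ (k + 1)"
proof -
  have U: "(UNIV :: letter set) = {Lx, Ly}" using letter.exhaust by auto
  have "finite (UNIV :: letter set)" by (simp add: U)
  then have "card (words_upto k) = (\<Sum>i\<le>k. card (UNIV :: letter set) ^ i)"
    using card_lists_length_le[of "UNIV :: letter set" k] by (simp add: words_upto_def)
  also have "\<dots> = (\<Sum>i\<le>k. 2 ^ i)" by (simp add: U numeral_2_eq_2)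
  also have "\<dots> \<le> 2 ^ (k + 1)" by (induction k) auto
  finally show ?thesis .
qed

theorem theoremB:
  shows "(\<forall>n::nat. n > 1 \<longrightarrow>
            real (terseness n) \<le>
              4 * real n * log 2 (real n) - 4 * real n * log 2 (log 2 (real n)) + 10 * real n + 1)
       \<and> (\<exists>C::real. \<forall>n::nat. n > 1 \<longrightarrow>
            real (card (words_upto (terseness n))) \<le>
              (real n / log 2 (real n)) ^ (4 * n) * 2 powr (C * real n))"
proof -
  have bound: "real (terseness n) \<le>
      4 * real n * log 2 (real n) - 4 * real n * log 2 (log 2 (real n)) + 10 * real n + 1"
    if n: "n > 1" for n
  proof -
    have "log 2 2 \<le> log 2 (real n)" using n by (intro log_mono) auto
    then have "2 * log 2 (log 2 (real n)) \<le> log 2 (real n) + 3" by (intro two_log2_le) simp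
    then have "2 * real n * (2 * log 2 (log 2 (real n))) \<le> 2 * real n * (log 2 (real n) + 3)"
      by (intro mult_left_mono) auto
    then show ?thesis using terseness_bound[OF n] by (simp add: algebra_simps)
  qed
  \<comment> \<open>There are fewer than \<open>2 ^ (terseness n + 1)\<close> words, and \<open>10 * n + 2 \<le> 11 * n\<close>; the power of
    \<open>n / log 2 n\<close> is 2 raised to the first two terms of the bound.\<close>
  moreover have "real (card (words_upto (terseness n))) \<le>
      (real n / log 2 (real n)) ^ (4 * n) * 2 powr (11 * real n)" if n: "n > 1" for n
  proof -
    define L where "L = log 2 (real n)"
    have L: "L > 0" using n by (simp add: L_def)
    have nL: "real n / L = 2 powr (L - log 2 L)"
      using n L by (simp add: powr_diff L_def)
    have "real (card (words_upto (terseness n))) \<le> real (2 ^ (terseness n + 1))"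
      using card_words_upto by (simp only: of_nat_le_iff)
    also have "\<dots> = 2 powr (real (terseness n) + 1)"
      by (simp add: powr_add powr_realpow)
    also have "\<dots> \<le> 2 powr ((L - log 2 L) * real (4 * n) + 11 * real n)"
    proof (rule powr_mono)
      show "real (terseness n) + 1 \<le> (L - log 2 L) * real (4 * n) + 11 * real n"
        using bound[OF n] n by (simp add: L_def algebra_simps)
    qed simp
    also have "\<dots> = (real n / L) ^ (4 * n) * 2 powr (11 * real n)"
      unfolding powr_add nL by (simp add: powr_powr[symmetric] powr_realpow power_mult[symmetric])
    finally show ?thesis by (simp add: L_def)
  qed
  ultimately show ?thesis by blast
qed

end
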